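(* Let $F$ be a forest with at least one edge, and let $r\geq 2$ be an integer. Then the threshold of the online $F$-avoidance game with $r$ colors is \[ N_0(F,r,n)=n^{1-1/k^*(F,r)}, \] where $k^*(F,r)$ is the smallest integer $k$ for which Builder has a winning strategy in the deterministic $F$-avoidance game with $r$ colors and tree size restriction $k$. Moreover, this threshold is attained by any winning strategy for Painter in the deterministic $F$-avoidance game with $r$ colors and tree size restriction $k^*(F,r)-1$, i.e., if Painter follows such a strategy then for any $N=o(n^{1-1/k^*(F,r)})$, asymptotically almost surely no monochromatic copy of $F$ is created in the first $N$ steps.
   Context: Online $F$-avoidance game with $r$ colors (probabilistic one-player game): the board is a graph on $n$ vertices, initially without edges. In each step a new edge is drawn uniformly at random from all non-edges and presented to Painter, who must immediately assign it one of $r$ colors. The game ends as soon as a monochromatic copy of $F$ is created. The threshold $N_0=N_0(F,r,n)$ is a function such that for any $N=o(N_0)$ there is a coloring strategy that asymptotically almost surely (probability $1-o(1)$ as $n\to\infty$) creates no monochromatic copy of $F$ in the first $N$ steps, while for $N=\omega(N_0)$ every online strategy a.a.s. creates a monochromatic copy of $F$ within the first $N$ steps. Deterministic $F$-avoidance game with $r$ colors and tree size restriction $k$: two players Builder and Painter play on a board with $a$ vertices. In each step Builder presents a new edge, which Painter must immediately color with one of $r$ colors; Painter loses as soon as a monochromatic copy of $F$ is created. Builder must never create a cycle on the board nor a component (tree) with more than $k$ edges (equivalently, the board $B$ must satisfy $\max_{H\subseteq B} e_H/v_H\le k/(k+1)$). Builder has a winning strategy if for some large enough $a$ he can force a monochromatic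 copy of $F$ on a board with $a$ vertices; Painter has a winning strategy if she can avoid a monochromatic copy of $F$ on every finite board. (For every forest $F$ and every $r$, Builder has a winning strategy for all sufficiently large $k$, so $k^*(F,r)$ is well defined.) *)

theory Defs
  imports "HOL-Probability.Probability" "HOL-Library.Landau_Symbols"
begin

text \<open>A simple graph is a vertex set together with a set of two-element edges.\<close>

definition all_edges :: "'a set \<Rightarrow> 'a set set" where
  "all_edges V = {e. e \<subseteq> V \<and> card e = 2}"

definition cycle :: "'a set set \<Rightarrow> 'a list \<Rightarrow> bool" where
  "cycle E vs \<longleftrightarrow> 3 \<le> length vs \<and> distinct vs \<and>
     (\<forall>i<length vs. {vs ! i, vs ! (Suc i mod length vs)} \<in> E)"

definition acyclic_graph :: "'a set set \<Rightarrow> bool" where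
  "acyclic_graph E \<longleftrightarrow> (\<nexists>vs. cycle E vs)"

definition forest :: "'a set \<Rightarrow> 'a set set \<Rightarrow> bool" where
  "forest V E \<longleftrightarrow> finite V \<and> E \<subseteq> all_edges V \<and> acyclic_graph E"

definition component :: "'a set set \<Rightarrow> 'a \<Rightarrow> 'a set" where
  "component E v = {(x, y). {x, y} \<in> E}\<^sup>* `` {v}"

definition component_edges :: "'a set set \<Rightarrow> 'a \<Rightarrow> 'a set set" where
  "component_edges E v = {e \<in> E. e \<subseteq> component E v}"

definition contains_copy :: "'b set \<Rightarrow> 'b set set \<Rightarrow> 'a set \<Rightarrow> 'a set set \<Rightarrow> bool" where
  "contains_copy W D V E \<longleftrightarrow>
     (\<exists>f. inj_on f V \<and> f ` V \<subseteq> W \<and> (\<forall>e\<in>E. f ` e \<in> D))"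

text \<open>
  The board with \<open>n\<close> vertices has vertex set \<open>{..<n}\<close>, and the \<open>r\<close> colours are \<open>{..<r}\<close>.
  A history lists the edges presented so far, in order, with the colours they received.
  Strategies may depend on the entire history.
\<close>

type_synonym history = "(nat set \<times> nat) list"
type_synonym painter = "history \<Rightarrow> nat set \<Rightarrow> nat"
type_synonym builder = "history \<Rightarrow> nat set"

definition board_edges :: "history \<Rightarrow> nat set set" where
  "board_edges h = fst ` set h"

definition mono_copy :: "'a set \<Rightarrow> 'a set set \<Rightarrow> nat \<Rightarrow> history \<Rightarrow> bool" where
  "mono_copy V E n h \<longleftrightarrow> (\<exists>c. contains_copy {..<n} {e. (e, c) \<in> set h} V E)"

definition painter_strategy :: "nat \<Rightarrow> painter \<Rightarrow> bool" where
  "painter_strategy r \<pi> \<longleftrightarrow> (\<forall>h e. \<pi> h e < r)"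

definition painter_follows :: "painter \<Rightarrow> history \<Rightarrow> bool" where
  "painter_follows \<pi> h \<longleftrightarrow> (\<forall>i<length h. snd (h ! i) = \<pi> (take i h) (fst (h ! i)))"

definition builder_follows :: "builder \<Rightarrow> history \<Rightarrow> bool" where
  "builder_follows \<beta> h \<longleftrightarrow> (\<forall>i<length h. fst (h ! i) = \<beta> (take i h))"

definition legal_move :: "nat \<Rightarrow> nat \<Rightarrow> nat set set \<Rightarrow> nat set \<Rightarrow> bool" where
  "legal_move a k B e \<longleftrightarrow> e \<in> all_edges {..<a} - B \<and>
     acyclic_graph (insert e B) \<and> (\<forall>v<a. card (component_edges (insert e B) v) \<le> k)"

definition legal_play :: "nat \<Rightarrow> nat \<Rightarrow> history \<Rightarrow> bool" where
  "legal_play a k h \<longleftrightarrow>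
     (\<forall>i<length h. legal_move a k (board_edges (take i h)) (fst (h ! i)))"

text \<open>
  A finite history that follows both strategies is a prefix of the play they determine, so
  the existential below says that a monochromatic copy appears after finitely many steps, all of
  them legal for Builder. Since copies persist, it is irrelevant whether the play goes on
  after the first monochromatic copy.
\<close>

definition builder_wins :: "'a set \<Rightarrow> 'a set set \<Rightarrow> nat \<Rightarrow> nat \<Rightarrow> bool" where
  "builder_wins V E r k \<longleftrightarrow>
     (\<exists>a \<beta>. \<forall>\<pi>. painter_strategy r \<pi> \<longrightarrow>
        (\<exists>h. builder_follows \<beta> h \<and> painter_follows \<pi> h \<and> legal_play a k h \<and> mono_copy V E a h))"

text \<open>
  A winning strategy of Painter consists of one strategy \<open>\<pi> a\<close> for each board size \<open>a\<close>. Its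
  values at positions that Builder cannot legally reach are unconstrained elements of \<open>{..<r}\<close>.
\<close>

definition painter_winning ::
    "'a set \<Rightarrow> 'a set set \<Rightarrow> nat \<Rightarrow> nat \<Rightarrow> (nat \<Rightarrow> painter) \<Rightarrow> bool" where
  "painter_winning V E r k \<pi> \<longleftrightarrow>
     (\<forall>a. painter_strategy r (\<pi> a) \<and>
        (\<forall>h. painter_follows (\<pi> a) h \<and> legal_play a k h \<longrightarrow> \<not> mono_copy V E a h))"

definition kstar :: "'a set \<Rightarrow> 'a set set \<Rightarrow> nat \<Rightarrow> nat" where
  "kstar V E r = (LEAST k. builder_wins V E r k)"

text \<open>
  The distribution of the history after \<open>N\<close> steps. Once the board is complete, no
  further edges are drawn. Edges keep arriving after the first monochromatic copy of the
  forbidden graph; since copies persist, this does not affect whether one is created within the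
  first \<open>N\<close> steps.
\<close>

primrec random_game :: "nat \<Rightarrow> painter \<Rightarrow> nat \<Rightarrow> history pmf" where
  "random_game n \<sigma> 0 = return_pmf []"
| "random_game n \<sigma> (Suc N) =
     bind_pmf (random_game n \<sigma> N) (\<lambda>h.
       let S = all_edges {..<n} - board_edges h
       in if S = {} then return_pmf h
          else map_pmf (\<lambda>e. h @ [(e, \<sigma> h e)]) (pmf_of_set S))"

definition aas_avoids ::
    "'a set \<Rightarrow> 'a set set \<Rightarrow> (nat \<Rightarrow> painter) \<Rightarrow> (nat \<Rightarrow> nat) \<Rightarrow> bool" where
  "aas_avoids V E \<sigma> N \<longleftrightarrow>
     (\<lambda>n. measure_pmf.prob (random_game n (\<sigma> n) (N n)) {h. \<not> mono_copy V E n h})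
       \<longlonglongrightarrow> 1"

definition aas_creates ::
    "'a set \<Rightarrow> 'a set set \<Rightarrow> (nat \<Rightarrow> painter) \<Rightarrow> (nat \<Rightarrow> nat) \<Rightarrow> bool" where
  "aas_creates V E \<sigma> N \<longleftrightarrow>
     (\<lambda>n. measure_pmf.prob (random_game n (\<sigma> n) (N n)) {h. mono_copy V E n h})
       \<longlonglongrightarrow> 1"

text \<open>Thresholds are only determined up to constant factors, hence a predicate on \<open>N\<^sub>0\<close>.\<close>

definition is_threshold ::
    "'a set \<Rightarrow> 'a set set \<Rightarrow> nat \<Rightarrow> (nat \<Rightarrow> real) \<Rightarrow> bool" where
  "is_threshold V E r N\<^sub>0 \<longleftrightarrow>
     (\<forall>N. (\<lambda>n. real (N n)) \<in> o(N\<^sub>0) \<longrightarrow>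
        (\<exists>\<sigma>. (\<forall>n. painter_strategy r (\<sigma> n)) \<and> aas_avoids V E \<sigma> N)) \<and>
     (\<forall>N. (\<lambda>n. real (N n)) \<in> \<omega>(N\<^sub>0) \<longrightarrow>
        (\<forall>\<sigma>. (\<forall>n. painter_strategy r (\<sigma> n)) \<longrightarrow> aas_creates V E \<sigma> N))"

end

theory Submission
  imports Defs "HOL-Real_Asymp.Real_Asymp"
begin

text \<open>
  Upper bound. Run the random game in constantly many rounds of \<open>m\<close> edges each and follow a winning
  strategy of Builder, keeping the invariant that every coloured component with \<open>e\<close> edges of the
  current deterministic position has \<open>\<Omega>(n (m/n)\<^sup>e)\<close> vertex-disjoint copies in the random game.
  If Builder joins two components, then in one round many random edges join copies of them in the same
  way; a constant fraction of these edges receives the same colour, and that colour is taken as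
  Painter's answer. As trees with at most \<open>k\<close> edges have \<open>n (m/n)\<^sup>k \<rightarrow> \<infinity>\<close> copies, the invariant
  survives until a monochromatic copy is forced.

  Lower bound. By the first moment method the random graph a.a.s. has no cycle and no component with
  \<open>k\<^sup>*\<close> edges, so it is a legal play of the deterministic game with tree size restriction \<open>k\<^sup>* - 1\<close>.
  A winning strategy of Painter for that game exists because finite games are determined.
\<close>

section \<open>Components and cycles\<close>

text \<open>Painter reacts to the whole history, so the random game cannot be treated as a random
  graph that is coloured afterwards. The estimates of the upper bound are therefore made relative to
  a starting history and for an arbitrary strategy; all that a round uses is that fresh random edges
  contain a large matching between two prescribed vertex sets. Copies are kept vertex-disjoint
  because such a matching then merges them into copies that are again disjoint, and because z
  vertices can spoil at most z of them. Each round costs a constant factor in the number of copies,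
  which is affordable because the number of moves of a forced win does not depend on n.

  The exponent solves n (m/n)^k = 1. In the lower bound the same expression is n^(k+1) (N/n^2)^k,
  the order of the expected number of trees with k edges on k + 1 vertices.

  That some k lets Builder win at all also has to be proved: restricted by acyclicity alone, Builder
  raises a potential, the sum over the colours of the depth of a monochromatic tree-like structure
  at one vertex, until one colour has room for the whole forest.\<close>

lemma sym_adj: "sym {(x, y). {x, y} \<in> B}"
  by (auto simp: sym_def insert_commute)

lemma component_refl [simp]: "v \<in> component B v"
  by (simp add: component_def)

lemma component_step: "x \<in> component B v \<Longrightarrow> {x, y} \<in> B \<Longrightarrow> y \<in> component B v"
  unfolding component_def by (auto intro: rtrancl_into_rtrancl)

lemma component_eq:
  assumes "w \<in> component B v" shows "component B w = component B v"
proof -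
  have s: "sym ({(x, y). {x, y} \<in> B}\<^sup>*)" by (rule sym_rtrancl[OF sym_adj])
  have vw: "(v, w) \<in> {(x, y). {x, y} \<in> B}\<^sup>*" using assms by (simp add: component_def)
  then have "(w, v) \<in> {(x, y). {x, y} \<in> B}\<^sup>*" using s by (meson symD)
  with vw show ?thesis unfolding component_def by (auto intro: rtrancl_trans)
qed

lemma component_sym: "w \<in> component B v \<Longrightarrow> v \<in> component B w"
  using component_eq component_refl by metis

lemma component_closed_subset:
  assumes "v \<in> X" and "\<And>x y. x \<in> X \<Longrightarrow> {x, y} \<in> B \<Longrightarrow> y \<in> X"
  shows "component B v \<subseteq> X"
proof
  fix w assume "w \<in> component B v"
  then have "(v, w) \<in> {(x, y). {x, y} \<in> B}\<^sup>*" by (simp add: component_def)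
  then show "w \<in> X" by (induction) (use assms in auto)
qed

lemma component_mono: "B \<subseteq> B' \<Longrightarrow> component B v \<subseteq> component B' v"
  by (rule component_closed_subset) (auto intro: component_step)

lemma component_edges_mono: "B \<subseteq> B' \<Longrightarrow> component_edges B v \<subseteq> component_edges B' v"
  using component_mono[of B B' v] unfolding component_edges_def by blast

lemma component_insert_other:
  assumes "w \<notin> component B u" "w \<notin> component B v"
  shows "component (insert {u, v} B) w = component B w"
proof
  show "component (insert {u, v} B) w \<subseteq> component B w"
    by (rule component_closed_subset)
      (use assms in \<open>auto simp: doubleton_eq_iff intro: component_step dest: component_sym\<close>)
qed (rule component_mono, blast)

lemma component_insert_union:
  assumes "w \<in> component B u \<union> component B v"
  shows "component (insert {u, v} B) w = component B u \<union> component B v" (is "?L = ?R")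
proof -
  have m: "component B x \<subseteq> component (insert {u, v} B) x" for x by (rule component_mono) blast
  have "v \<in> component (insert {u, v} B) u" by (rule component_step[OF component_refl]) simp
  then have uv: "component (insert {u, v} B) v = component (insert {u, v} B) u"
    by (rule component_eq)
  have "w \<in> component (insert {u, v} B) u" using assms m[of u] m[of v] uv by blast
  then have w: "?L = component (insert {u, v} B) u" by (rule component_eq)
  have "component (insert {u, v} B) u \<subseteq> ?R"
    by (rule component_closed_subset) (auto simp: doubleton_eq_iff intro: component_step)
  with w m[of u] m[of v] uv show ?thesis by blast
qed

lemma edge_subset_component:
  assumes "e \<in> B" "card e = 2" "x \<in> e"
  shows "e \<subseteq> component B x"
proof -
  obtain p q where e: "e = {p, q}" using assms(2) by (auto simp: card_2_iff)
  show ?thesis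
    using assms component_step[OF component_refl, of p q B] component_step[OF component_refl, of q p B]
    by (auto simp: e insert_commute)
qed

lemma components_disjoint: "v \<notin> component B u \<Longrightarrow> component B u \<inter> component B v = {}"
  using component_eq component_refl by (metis disjoint_iff)

lemma edge_subset_component_union:
  assumes "e \<in> B" "card e = 2" "e \<subseteq> component B u \<union> component B v"
  shows "e \<subseteq> component B u \<or> e \<subseteq> component B v"
proof -
  obtain x where x: "x \<in> e" using assms(2) by fastforce
  have "e \<subseteq> component B x" by (rule edge_subset_component[OF assms(1,2) x])
  then show ?thesis using assms(3) x component_eq by (metis UnE subsetD)
qed

section \<open>Paths, cycles and vertices of low degree\<close>

lemma component_simple_path:
  assumes "v \<in> component B u"
  shows "\<exists>p. p \<noteq> [] \<and> hd p = u \<and> last p = v \<and> distinct p \<and>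
    (\<forall>i. Suc i < length p \<longrightarrow> {p ! i, p ! Suc i} \<in> B)"
proof -
  have "(u, v) \<in> {(x, y). {x, y} \<in> B}\<^sup>*" using assms by (simp add: component_def)
  then show ?thesis
  proof (induction)
    case base
    show ?case by (rule exI[of _ "[u]"]) auto
  next
    case (step y z)
    then obtain p where p: "p \<noteq> []" "hd p = u" "last p = y" "distinct p"
      "\<And>i. Suc i < length p \<Longrightarrow> {p ! i, p ! Suc i} \<in> B" by blast
    have yz: "{y, z} \<in> B" using step by simp
    show ?case
    proof (cases "z \<in> set p")
      case True
      then obtain j where j: "j < length p" "p ! j = z" by (auto simp: in_set_conv_nth)
      \<comment> \<open>If \<open>z\<close> already lies on the path, the path is cut there instead
        of being extended.\<close>
      have "last (take (Suc j) p) = z"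
        using j by (simp add: take_Suc_conv_app_nth)
      then show ?thesis
        by (intro exI[of _ "take (Suc j) p"]) (use p j in \<open>auto simp: hd_take\<close>)
    next
      case False
      have "{(p @ [z]) ! i, (p @ [z]) ! Suc i} \<in> B" if "Suc i < length (p @ [z])" for i
      proof (cases "Suc i < length p")
        case True
        then show ?thesis using p(5)[OF True] by (simp add: nth_append)
      next
        case False
        then have "i = length p - 1" "i < length p" using that p(1) by auto
        then show ?thesis using yz p(1,3) by (simp add: nth_append last_conv_nth)
      qed
      then show ?thesis
        by (intro exI[of _ "p @ [z]"]) (use p False in auto)
    qed
  qed
qed

text \<open>The new edge would close a simple path from \<open>u\<close> to \<open>v\<close> in
  \<open>B\<close> to a cycle. The path has at least three vertices, because
  \<open>u \<noteq> v\<close> rules out one and \<open>{u, v} \<notin> B\<close> rules out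
  two.\<close>

lemma acyclic_insert_imp_disconnected:
  assumes "acyclic_graph (insert {u, v} B)" "{u, v} \<notin> B" "u \<noteq> v"
  shows "v \<notin> component B u"
proof
  assume "v \<in> component B u"
  from component_simple_path[OF this] obtain p where p: "p \<noteq> []" "hd p = u" "last p = v"
    "distinct p" "\<And>i. Suc i < length p \<Longrightarrow> {p ! i, p ! Suc i} \<in> B" by blast
  have hl: "p ! 0 = u" "p ! (length p - 1) = v"
    using p by (auto simp: hd_conv_nth last_conv_nth)
  have "length p \<noteq> 1" using hl assms(3) by auto
  moreover have "length p \<noteq> 2" using hl assms(2) p(5)[of 0] by auto
  moreover have "length p \<noteq> 0" using p by auto
  ultimately have len: "3 \<le> length p" by linarith
  have "{p ! i, p ! (Suc i mod length p)} \<in> insert {u, v} B" if "i < length p" for i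
  proof (cases "Suc i < length p")
    case True then show ?thesis using p(5)[OF True] by simp
  next
    case False
    then have "i = length p - 1" "Suc i = length p" using that by auto
    then show ?thesis using hl by (simp add: insert_commute)
  qed
  then have "cycle (insert {u, v} B) p" using len p(4) by (simp add: cycle_def)
  then show False using assms(1) by (auto simp: acyclic_graph_def)
qed

text \<open>If the edges at two distinct positions coincided, each position would be the cyclic
  successor of the other, which forces the length to be at most 2.\<close>

lemma inj_on_cycle_edges:
  assumes "3 \<le> length vs" "distinct vs"
  shows "inj_on (\<lambda>i. {vs ! i, vs ! (Suc i mod length vs)}) {..<length vs}"
proof (rule inj_onI)
  let ?l = "length vs"
  fix i j assume ij: "i \<in> {..<?l}" "j \<in> {..<?l}"
    and eq: "{vs ! i, vs ! (Suc i mod ?l)} = {vs ! j, vs ! (Suc j mod ?l)}"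
  have "0 < ?l" using assms(1) by linarith
  then have m: "Suc i mod ?l < ?l" "Suc j mod ?l < ?l" by (rule mod_less_divisor)+
  show "i = j"
  proof (rule ccontr)
    assume "i \<noteq> j"
    then have "vs ! i = vs ! (Suc j mod ?l)" "vs ! (Suc i mod ?l) = vs ! j"
      using eq ij assms(2) by (auto simp: doubleton_eq_iff nth_eq_iff_index_eq)
    then have "i = Suc j mod ?l" "j = Suc i mod ?l"
      using ij m assms(2) by (auto simp: nth_eq_iff_index_eq)
    moreover have "Suc x mod ?l = (if Suc x = ?l then 0 else Suc x)" if "x \<in> {..<?l}" for x
      using that by auto
    ultimately show False using ij assms(1) by (auto split: if_splits)
  qed
qed

text \<open>A cycle through the new edge uses it only once, so the rest of the cycle is a walk in
  \<open>B\<close> between \<open>u\<close> and \<open>v\<close>.\<close>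

lemma acyclic_insert:
  assumes "acyclic_graph B" "v \<notin> component B u"
  shows "acyclic_graph (insert {u, v} B)"
  unfolding acyclic_graph_def
proof
  assume "\<exists>vs. cycle (insert {u, v} B) vs"
  then obtain vs where c: "cycle (insert {u, v} B) vs" by blast
  define l where "l = length vs"
  define ed where "ed i = {vs ! i, vs ! (Suc i mod l)}" for i
  have l: "3 \<le> l" "distinct vs" "\<And>i. i < l \<Longrightarrow> ed i \<in> insert {u, v} B"
    using c by (auto simp: cycle_def l_def ed_def)
  have inj: "inj_on ed {..<l}"
    using inj_on_cycle_edges[of vs] l unfolding ed_def l_def by blast
  have "\<not> cycle B vs" using assms(1) by (auto simp: acyclic_graph_def)
  then obtain i where i: "i < l" "ed i \<notin> B"
    using l by (auto simp: cycle_def l_def ed_def)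
  then have ei: "ed i = {u, v}" using l(3) by blast
  \<comment> \<open>\<open>w\<close> runs once around the cycle, starting just behind the new edge
    at position \<open>i\<close> and ending at \<open>vs ! i\<close>.\<close>
  define w where "w j = vs ! ((Suc i + j) mod l)" for j
  have "w j \<in> component B (w 0)" if "j < l" for j
    using that
  proof (induction j)
    case (Suc j)
    have "(Suc i + j) mod l \<noteq> i"
    proof
      assume a: "(Suc i + j) mod l = i"
      show False
      proof (cases "Suc i + j < l")
        case True then show False using a by simp
      next
        case False
        then have "(Suc i + j) mod l = Suc i + j - l" using Suc.prems i(1)
          by (simp add: mod_if le_mod_geq)
        then show False using a Suc.prems False by linarith
      qed
    qed
    moreover have "(Suc i + j) mod l < l" using l by simp
    ultimately have "ed ((Suc i + j) mod l) \<noteq> ed i"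
      using inj i by (auto simp: inj_on_def)
    then have "ed ((Suc i + j) mod l) \<in> B"
      using l(3)[of "(Suc i + j) mod l"] ei \<open>(Suc i + j) mod l < l\<close> by auto
    moreover have "ed ((Suc i + j) mod l) = {w j, w (Suc j)}"
      by (simp add: ed_def w_def mod_Suc_eq)
    ultimately show ?case using component_step[of "w j" B] Suc by auto
  qed simp
  from this[of "l - 1"] have "w (l - 1) \<in> component B (w 0)" using l by simp
  moreover have "w (l - 1) = vs ! i" using i l by (simp add: w_def)
  moreover have "w 0 = vs ! (Suc i mod l)" by (simp add: w_def)
  ultimately have "vs ! i \<in> component B (vs ! (Suc i mod l))" by simp
  then show False using ei assms(2) component_sym[of u B v]
    by (auto simp: ed_def doubleton_eq_iff)
qed

lemma acyclic_subset: "acyclic_graph B' \<Longrightarrow> B \<subseteq> B' \<Longrightarrow> acyclic_graph B"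
  unfolding acyclic_graph_def cycle_def by blast

text \<open>The end of a longest path works: a neighbour off the path would lengthen it, and a
  neighbour on the path other than its second vertex would close a cycle.\<close>

lemma acyclic_low_degree_vertex:
  assumes "finite V" "V \<noteq> {}" "E \<subseteq> all_edges V" "acyclic_graph E"
  shows "\<exists>x\<in>V. \<forall>y z. {x, y} \<in> E \<longrightarrow> {x, z} \<in> E \<longrightarrow> y = z"
proof -
  define P where "P p \<longleftrightarrow> p \<noteq> [] \<and> distinct p \<and> set p \<subseteq> V \<and>
    (\<forall>i. Suc i < length p \<longrightarrow> {p ! i, p ! Suc i} \<in> E)" for p
  obtain v where "v \<in> V" using assms by blast
  then have "P [v]" by (simp add: P_def)
  moreover have "\<forall>p. P p \<longrightarrow> length p < Suc (card V)"
    using assms(1) by (auto simp: P_def less_Suc_eq_le distinct_card[symmetric] intro: card_mono)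
  ultimately obtain p where p: "P p" and max: "\<And>q. P q \<Longrightarrow> length q \<le> length p"
    using ex_has_greatest_nat[of P "[v]" length "Suc (card V)"] by blast
  define x where "x = p ! 0"
  have p': "p \<noteq> []" "distinct p" "set p \<subseteq> V" "\<And>i. Suc i < length p \<Longrightarrow> {p ! i, p ! Suc i} \<in> E"
    using p by (auto simp: P_def)
  have "y = p ! 1" if xy: "{x, y} \<in> E" for y
  proof (rule ccontr)
    assume ne: "y \<noteq> p ! 1"
    have yV: "y \<in> V" "x \<noteq> y" using xy assms(3) by (auto simp: all_edges_def)
    have "y \<in> set p"
    proof (rule ccontr)
      assume "y \<notin> set p"
      have "{(y # p) ! i, (y # p) ! Suc i} \<in> E" if "Suc i < length (y # p)" for i
        using that p'(4) xy by (cases i) (auto simp: x_def insert_commute)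
      then have "P (y # p)" using p' yV \<open>y \<notin> set p\<close> by (simp add: P_def)
      from max[OF this] show False by simp
    qed
    then obtain j where j: "j < length p" "p ! j = y" by (auto simp: in_set_conv_nth)
    then have j2: "2 \<le> j" using ne yV(2) unfolding x_def
      by (metis One_nat_def less_2_cases_iff not_less)
    let ?q = "take (Suc j) p"
    have "{?q ! i, ?q ! (Suc i mod length ?q)} \<in> E" if "i < length ?q" for i
    proof (cases "i = j")
      case True
      have "length ?q = Suc j" using j by simp
      with True show ?thesis using j xy by (simp add: x_def insert_commute)
    next
      case False
      then have "i < j" "length ?q = Suc j" using that j by auto
      then show ?thesis using j p'(4)[of i] by simp
    qed
    then have "cycle E ?q" using j j2 p'(2) by (simp add: cycle_def)
    then show False using assms(4) by (auto simp: acyclic_graph_def)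
  qed
  moreover have "x \<in> V" using p'(1,3) by (auto simp: x_def)
  ultimately show ?thesis by metis
qed

section \<open>Determinacy of the deterministic game\<close>

lemma board_edges_Nil [simp]: "board_edges [] = {}"
  by (simp add: board_edges_def)

lemma board_edges_snoc [simp]: "board_edges (h @ [(e, c)]) = insert e (board_edges h)"
  by (auto simp: board_edges_def)

lemma finite_board_edges [simp]: "finite (board_edges h)"
  by (simp add: board_edges_def)

lemma finite_all_edges [simp]: "finite V \<Longrightarrow> finite (all_edges V)"
  by (simp add: all_edges_def)

lemma all_edges_doubleton [simp]: "{u, v} \<in> all_edges V \<longleftrightarrow> u \<in> V \<and> v \<in> V \<and> u \<noteq> v"
  by (auto simp: all_edges_def card_2_iff doubleton_eq_iff)

lemma all_edges_obtain:
  assumes "e \<in> all_edges V"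
  obtains u v where "e = {u, v}" "u \<noteq> v" "u \<in> V" "v \<in> V"
  using assms by (auto simp: all_edges_def card_2_iff)

lemma mono_copy_mono: "mono_copy V E n h \<Longrightarrow> set h \<subseteq> set h' \<Longrightarrow> mono_copy V E n h'"
  unfolding mono_copy_def contains_copy_def by blast

lemma legal_play_Nil [simp]: "legal_play a k []"
  by (simp add: legal_play_def)

lemma legal_play_snoc [simp]:
  "legal_play a k (h @ [(e, c)]) \<longleftrightarrow> legal_play a k h \<and> legal_move a k (board_edges h) e"
  unfolding legal_play_def by (auto simp: nth_append less_Suc_eq)

lemma painter_follows_Nil [simp]: "painter_follows \<pi> []"
  by (simp add: painter_follows_def)

lemma painter_follows_snoc [simp]:
  "painter_follows \<pi> (h @ [(e, c)]) \<longleftrightarrow> painter_follows \<pi> h \<and> c = \<pi> h e"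
  unfolding painter_follows_def by (auto simp: nth_append less_Suc_eq)

lemma builder_follows_Nil [simp]: "builder_follows \<beta> []"
  by (simp add: builder_follows_def)

lemma builder_follows_snoc [simp]:
  "builder_follows \<beta> (h @ [(e, c)]) \<longleftrightarrow> builder_follows \<beta> h \<and> e = \<beta> h"
  unfolding builder_follows_def by (auto simp: nth_append less_Suc_eq)

lemma legal_play_edges: "legal_play a k h \<Longrightarrow>
    board_edges h \<subseteq> all_edges {..<a} \<and> card (board_edges h) = length h"
  by (induction h rule: rev_induct) (auto simp: legal_move_def)

lemma legal_play_acyclic: "legal_play a k h \<Longrightarrow> acyclic_graph (board_edges h)"
proof (cases h rule: rev_cases)
  case Nil
  have "\<not> cycle {} vs" for vs :: "nat list" by (cases vs) (auto simp: cycle_def)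
  then show ?thesis by (simp add: Nil acyclic_graph_def)
qed (auto simp: legal_move_def)

lemma legal_play_length: "legal_play a k h \<Longrightarrow> length h \<le> card (all_edges {..<a})"
  using legal_play_edges[of a k h] card_mono[of "all_edges {..<a}" "board_edges h"] by simp

text \<open>Backward induction: \<open>d\<close> bounds the number of edges that Builder still
  presents, and Painter's strategy is replaced by a quantifier over the answers. In this
  strategy-free form the win can be imitated in the random game, one level per round.\<close>

primrec force :: "'a set \<Rightarrow> 'a set set \<Rightarrow> nat \<Rightarrow> nat \<Rightarrow> nat \<Rightarrow> nat \<Rightarrow> history \<Rightarrow> bool" where
  "force V E r a k 0 g \<longleftrightarrow> mono_copy V E a g"
| "force V E r a k (Suc d) g \<longleftrightarrow> mono_copy V E a g \<or>
     (\<exists>e. legal_move a k (board_edges g) e \<and> (\<forall>c<r. force V E r a k d (g @ [(e, c)])))"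

lemma force_Suc: "force V E r a k d g \<Longrightarrow> force V E r a k (Suc d) g"
proof (induction d arbitrary: g)
  case (Suc d)
  then show ?case by (metis force.simps(2))
qed simp

lemma force_mono: "d \<le> d' \<Longrightarrow> force V E r a k d g \<Longrightarrow> force V E r a k d' g"
  by (induction d' rule: dec_induct) (use force_Suc in blast)+

text \<open>Painter answers so that the position stays unforced for the number of edges that the
  board can still take. As each legal move uses a new edge, Builder never has more moves than
  that.\<close>

lemma not_force_imp_painter:
  assumes "\<not> force V E r a k (card (all_edges {..<a})) []" and "r > 0"
  shows "\<exists>\<pi>. painter_strategy r \<pi> \<and>
    (\<forall>h. painter_follows \<pi> h \<and> legal_play a k h \<longrightarrow> \<not> mono_copy V E a h)"
proof -
  let ?K = "card (all_edges {..<a})"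
  define safe where "safe h \<longleftrightarrow> \<not> force V E r a k (?K - length h) h" for h
  \<comment> \<open>The default \<open>0\<close> makes \<open>\<pi>\<close> total; it never serves
    as the answer to a legal move in a legal play against \<open>\<pi>\<close>.\<close>
  define \<pi> where "\<pi> h e = (if \<exists>c<r. safe (h @ [(e, c)]) then SOME c. c < r \<and> safe (h @ [(e, c)]) else 0)"
    for h e
  have \<pi>: "\<pi> h e < r" for h e
    unfolding \<pi>_def using assms(2) by (auto intro: someI2_ex)
  have "safe h" if "painter_follows \<pi> h" "legal_play a k h" for h
    using that
  proof (induction h rule: rev_induct)
    case Nil
    then show ?case using assms(1) by (simp add: safe_def)
  next
    case (snoc x h)
    obtain e c where x: "x = (e, c)" by fastforce
    \<comment> \<open>This keeps the truncated subtraction in \<open>safe\<close> from bottoming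
      out, so that the budget really drops by one.\<close>
    have "length (h @ [x]) \<le> ?K" using legal_play_length[OF snoc.prems(2)] .
    then have "?K - length h = Suc (?K - length (h @ [x]))" by simp
    moreover have "safe h" "legal_move a k (board_edges h) e" "c = \<pi> h e"
      using snoc by (auto simp: x)
    ultimately have "\<exists>c<r. safe (h @ [(e, c)])" by (auto simp: safe_def x)
    then have "safe (h @ [(e, \<pi> h e)])" unfolding \<pi>_def by (auto intro: someI2_ex)
    then show ?case using \<open>c = \<pi> h e\<close> x by simp
  qed
  moreover have "safe h \<Longrightarrow> \<not> mono_copy V E a h" for h
    unfolding safe_def by (metis force.simps(1) force_mono le0)
  ultimately show ?thesis using \<pi> by (auto simp: painter_strategy_def)
qed

text \<open>Builder's strategy sees only the history, so it recovers the remaining number of moves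
  from the length of the history. Hence the induction maintains
  \<open>m + length g = d\<close>.\<close>

lemma force_imp_builder_wins:
  assumes "force V E r a k d []"
  shows "builder_wins V E r k"
proof -
  define \<beta> where "\<beta> g = (SOME e. legal_move a k (board_edges g) e \<and>
    (\<forall>c<r. force V E r a k (d - Suc (length g)) (g @ [(e, c)])))" for g :: history
  have "\<exists>h. builder_follows \<beta> h \<and> painter_follows \<pi> h \<and> legal_play a k h \<and> mono_copy V E a h"
    if \<pi>: "painter_strategy r \<pi>" for \<pi>
  proof -
    have "\<exists>h. builder_follows \<beta> h \<and> painter_follows \<pi> h \<and> legal_play a k h \<and> mono_copy V E a h"
      if "builder_follows \<beta> g" "painter_follows \<pi> g" "legal_play a k g" "force V E r a k m g"
        "m + length g = d" for g m
      using that
    proof (induction m arbitrary: g)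
      case 0
      then show ?case by auto
    next
      case (Suc m)
      show ?case
      proof (cases "mono_copy V E a g")
        case True
        then show ?thesis using Suc by blast
      next
        case False
        have m: "m = d - Suc (length g)" using Suc.prems(5) by simp
        have "legal_move a k (board_edges g) (\<beta> g) \<and>
            (\<forall>c<r. force V E r a k (d - Suc (length g)) (g @ [(\<beta> g, c)]))"
          unfolding \<beta>_def by (rule someI_ex) (use False Suc.prems(4) m in auto)
        moreover have "\<pi> g (\<beta> g) < r" using \<pi> by (simp add: painter_strategy_def)
        ultimately show ?thesis
          by (intro Suc.IH[of "g @ [(\<beta> g, \<pi> g (\<beta> g))]"]) (use Suc.prems m in auto)
      qed
    qed
    from this[of "[]" d] show ?thesis using assms by simp
  qed
  then show ?thesis unfolding builder_wins_def by blast
qed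

text \<open>Determinacy: without a forced win on any board, the Painter strategy obtained by
  backward induction on Builder's board defeats \<open>\<beta>\<close>.\<close>

lemma builder_wins_imp_force:
  assumes "builder_wins V E r k" "r > 0"
  shows "\<exists>a d. force V E r a k d []"
proof (rule ccontr)
  assume n: "\<not> (\<exists>a d. force V E r a k d [])"
  obtain a \<beta> where b: "\<And>\<pi>. painter_strategy r \<pi> \<Longrightarrow> \<exists>h. builder_follows \<beta> h \<and> painter_follows \<pi> h \<and>
      legal_play a k h \<and> mono_copy V E a h"
    using assms(1) unfolding builder_wins_def by blast
  then show False using not_force_imp_painter[of V E r a k] n assms(2) by blast
qed

lemma painter_winning_exists:
  assumes "\<not> builder_wins V E r k" "r > 0"
  shows "\<exists>\<pi>. painter_winning V E r k \<pi>"
proof -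
  have "\<exists>p. painter_strategy r p \<and>
      (\<forall>h. painter_follows p h \<and> legal_play a k h \<longrightarrow> \<not> mono_copy V E a h)" for a
    using not_force_imp_painter[of V E r a k] assms force_imp_builder_wins by blast
  then show ?thesis unfolding painter_winning_def by metis
qed

lemma mono_copy_Nil: "E \<noteq> {} \<Longrightarrow> \<not> mono_copy V E a []"
  by (auto simp: mono_copy_def contains_copy_def)

text \<open>The first edge already forms a component with one edge, so Builder has no move. This
  makes \<open>kstar\<close> positive: \<open>kstar - 1\<close> is a true predecessor and
  \<open>1 / kstar\<close> is no division by zero.\<close>

lemma not_builder_wins_0:
  assumes "E \<noteq> {}" "r > 0"
  shows "\<not> builder_wins V E r 0"
proof
  assume "builder_wins V E r 0"
  moreover have "painter_strategy r (\<lambda>h e. 0)" using assms(2) by (simp add: painter_strategy_def)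
  ultimately obtain a h where h: "legal_play a 0 h" "mono_copy V E a h"
    unfolding builder_wins_def by blast
  have "\<not> legal_move a 0 B e" if "finite B" for B e
  proof
    assume l: "legal_move a 0 B e"
    then obtain u v where e: "e = {u, v}" "u < a" by (auto simp: legal_move_def elim: all_edges_obtain)
    have "v \<in> component (insert e B) u" by (rule component_step[OF component_refl]) (simp add: e)
    then have "e \<in> component_edges (insert e B) u" by (simp add: component_edges_def e)
    moreover have "finite (component_edges (insert e B) u)" using that by (simp add: component_edges_def)
    ultimately show False using l e(2) by (auto simp: legal_move_def)
  qed
  then have "h = []" using h(1) by (cases h rule: rev_cases) auto
  then show False using h(2) mono_copy_Nil[OF assms(1)] by blast
qed

section \<open>Builder can force every forest\<close>

text \<open>Walks of length \<open>m\<close> from \<open>v\<close> branch at least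
  \<open>d\<close>-fold at every step, but branches may overlap or run back. An embedding of a
  forest with at most \<open>d\<close> vertices can still dodge the vertices it has already
  used.\<close>

primrec rich :: "nat set set \<Rightarrow> nat \<Rightarrow> nat \<Rightarrow> nat \<Rightarrow> bool" where
  "rich D d 0 v \<longleftrightarrow> True"
| "rich D d (Suc m) v \<longleftrightarrow> (\<exists>W. finite W \<and> d \<le> card W \<and> (\<forall>w\<in>W. {v, w} \<in> D \<and> rich D d m w))"

lemma rich_superset: "rich D d m v \<Longrightarrow> D \<subseteq> D' \<Longrightarrow> rich D' d m v"
proof (induction m arbitrary: v)
  case (Suc m)
  then obtain W where "finite W" "d \<le> card W" "\<forall>w\<in>W. {v, w} \<in> D \<and> rich D d m w" by auto
  with Suc show ?case by (auto intro!: exI[of _ W])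
qed simp

lemma rich_Suc: "rich D d (Suc m) v \<Longrightarrow> rich D d m v"
proof (induction m arbitrary: v)
  case (Suc m)
  from Suc.prems obtain W where "finite W" "d \<le> card W"
    "\<forall>w\<in>W. {v, w} \<in> D \<and> rich D d (Suc m) w" using rich.simps(2) by blast
  with Suc.IH show ?case using rich.simps(2) by blast
qed simp

lemma rich_le: "m \<le> m' \<Longrightarrow> rich D d m' v \<Longrightarrow> rich D d m v"
  by (induction m' rule: dec_induct) (use rich_Suc in blast)+

text \<open>Remove a vertex \<open>x\<close> of degree at most one, embed the rest, and put
  \<open>x\<close> back next to the image of its neighbour. Each vertex costs one level of depth:
  all placed vertices keep depth \<open>N - card V\<close>, so that any of them can be extended
  later.\<close>

lemma rich_embeds_forest:
  assumes "forest V E" "card V \<le> N" "N \<le> d" "D \<subseteq> all_edges {..<a}" "rich D d (Suc N) v"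
  shows "\<exists>f. inj_on f V \<and> f ` V \<subseteq> {..<a} \<and> (\<forall>e\<in>E. f ` e \<in> D) \<and>
    (\<forall>y\<in>V. rich D d (N - card V) (f y))"
  using assms(1,2)
proof (induction "card V" arbitrary: V E)
  case 0
  then have "V = {}" "E = {}" by (auto simp: forest_def all_edges_def)
  then show ?case by simp
next
  case (Suc n)
  have fin: "finite V" and E: "E \<subseteq> all_edges V" and ac: "acyclic_graph E"
    using Suc.prems by (auto simp: forest_def)
  have "V \<noteq> {}" using Suc.hyps(2) by auto
  from acyclic_low_degree_vertex[OF fin this E ac] obtain x where x: "x \<in> V"
    "\<And>y z. {x, y} \<in> E \<Longrightarrow> {x, z} \<in> E \<Longrightarrow> y = z" by blast
  let ?V = "V - {x}" and ?E = "{e \<in> E. x \<notin> e}"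
  have fo: "forest ?V ?E"
    using fin E acyclic_subset[OF ac, of ?E] by (auto simp: forest_def all_edges_def)
  have cV: "card ?V = n" using Suc.hyps(2) x fin by simp
  have "n < N" using Suc.hyps(2) Suc.prems by simp
  from Suc.hyps(1)[OF cV[symmetric] fo] cV \<open>n < N\<close> obtain f where f: "inj_on f ?V" "f ` ?V \<subseteq> {..<a}"
    "\<And>e. e \<in> ?E \<Longrightarrow> f ` e \<in> D" "\<And>y. y \<in> ?V \<Longrightarrow> rich D d (N - n) (f y)" by auto
  have N: "N - n = Suc (N - card V)" using \<open>n < N\<close> Suc.hyps(2) by simp
  have card_f: "card (f ` ?V) < d"
    using card_image_le[of ?V f] fin cV \<open>n < N\<close> assms(3) by simp
  \<comment> \<open>Fewer than \<open>d\<close> vertices are occupied so far, so one of the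
    \<open>d\<close> neighbours is free.\<close>
  have pick: "\<exists>w. {p, w} \<in> D \<and> rich D d m w \<and> w \<notin> f ` ?V" if r: "rich D d (Suc m) p" for p m
  proof -
    obtain W where W: "finite W" "d \<le> card W" "\<forall>w\<in>W. {p, w} \<in> D \<and> rich D d m w"
      using r by auto
    have "\<not> W \<subseteq> f ` ?V"
    proof
      assume "W \<subseteq> f ` ?V"
      then have "card W \<le> card (f ` ?V)" using fin by (intro card_mono) auto
      then show False using W(2) card_f by simp
    qed
    then show ?thesis using W(3) by blast
  qed
  have "\<exists>w. w < a \<and> rich D d (N - card V) w \<and> w \<notin> f ` ?V \<and> (\<forall>y. {x, y} \<in> E \<longrightarrow> {w, f y} \<in> D)"
  proof (cases "\<exists>y. {x, y} \<in> E")
    case True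
    then obtain y where y: "{x, y} \<in> E" by blast
    then have "{x, y} \<in> all_edges V" using E by blast
    then have "y \<in> ?V" by auto
    then have "rich D d (Suc (N - card V)) (f y)" using f(4) N by auto
    from pick[OF this] obtain w where w: "{f y, w} \<in> D" "rich D d (N - card V) w" "w \<notin> f ` ?V"
      by blast
    have "w < a" using w(1) assms(4) by auto
    moreover have "\<forall>y'. {x, y'} \<in> E \<longrightarrow> {w, f y'} \<in> D"
      using x(2)[OF y] w(1) by (auto simp: insert_commute)
    ultimately show ?thesis using w by blast
  next
    case False
    \<comment> \<open>An isolated \<open>x\<close> goes next to the root \<open>v\<close>, whose
      extra level leaves depth \<open>N\<close>.\<close>
    from pick[OF assms(5)] obtain w where w: "{v, w} \<in> D" "rich D d N w" "w \<notin> f ` ?V" by blast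
    have "w < a" using w(1) assms(4) by auto
    moreover have "rich D d (N - card V) w" using rich_le[OF _ w(2)] by simp
    ultimately show ?thesis using w False by blast
  qed
  then obtain w where w: "w < a" "rich D d (N - card V) w" "w \<notin> f ` ?V"
    "\<And>y. {x, y} \<in> E \<Longrightarrow> {w, f y} \<in> D" by blast
  let ?f = "f(x := w)"
  have "inj_on ?f V" using f(1) w(3) by (auto simp: inj_on_def)
  moreover have "?f ` V \<subseteq> {..<a}" using f(2) w(1) by auto
  moreover have "?f ` e \<in> D" if e: "e \<in> E" for e
  proof (cases "x \<in> e")
    case True
    obtain p q where pq: "e = {p, q}" "p \<noteq> q" using e E by (blast elim: all_edges_obtain)
    then obtain y where "e = {x, y}" "y \<noteq> x" using True by auto
    then show ?thesis using w(4)[of y] e by (simp add: insert_commute)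
  next
    case False
    then have "?f ` e = f ` e" by auto
    then show ?thesis using f(3) e False by auto
  qed
  moreover have "rich D d (N - card V) (?f y)" if "y \<in> V" for y
    using f(4)[of y] that w(2) rich_Suc N by auto
  ultimately show ?case by blast
qed

text \<open>Taking the number of all pairs as the tree size leaves acyclicity as the only constraint
  on Builder.\<close>

definition acyclic_play :: "nat \<Rightarrow> painter \<Rightarrow> history \<Rightarrow> bool" where
  "acyclic_play a \<pi> h \<longleftrightarrow> painter_follows \<pi> h \<and> legal_play a (card (all_edges {..<a})) h"

lemma acyclic_play_extend:
  assumes "acyclic_play a \<pi> h" "u < a" "v < a" "v \<notin> component (board_edges h) u"
  shows "acyclic_play a \<pi> (h @ [({u, v}, \<pi> h {u, v})])"
proof -
  have B: "board_edges h \<subseteq> all_edges {..<a}" "acyclic_graph (board_edges h)"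
    using assms(1) legal_play_edges legal_play_acyclic unfolding acyclic_play_def by blast+
  have "u \<noteq> v" using assms(4) by auto
  moreover have "{u, v} \<notin> board_edges h"
    using assms(4) component_step[OF component_refl] by metis
  moreover have "acyclic_graph (insert {u, v} (board_edges h))"
    by (rule acyclic_insert[OF B(2) assms(4)])
  moreover have "card (component_edges (insert {u, v} (board_edges h)) w) \<le> card (all_edges {..<a})" for w
    using B(1) assms(2,3) \<open>u \<noteq> v\<close> by (intro card_mono) (auto simp: component_edges_def)
  ultimately show ?thesis using assms by (simp add: acyclic_play_def legal_move_def)
qed

lemma component_union_elsewhere:
  assumes "component B x \<subseteq> U" "\<And>e. e \<in> B' \<Longrightarrow> e \<inter> U = {}"
  shows "component (B \<union> B') x = component B x"
proof
  show "component (B \<union> B') x \<subseteq> component B x"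
  proof (rule component_closed_subset)
    fix y z assume "y \<in> component B x" "{y, z} \<in> B \<union> B'"
    then show "z \<in> component B x" using assms component_step[of y B x z] by blast
  qed simp
qed (rule component_mono, simp)

lemma board_edges_append: "board_edges (g @ t) = board_edges g \<union> board_edges t"
  by (auto simp: board_edges_def)

text \<open>Repeats a construction on \<open>q\<close> disjoint blocks of untouched vertices.
  Monotonicity of \<open>P\<close> keeps earlier results valid, and no edge runs between blocks, so
  the vertices found lie in different components and may be joined later.\<close>

lemma force_many:
  assumes claim: "\<And>g U. \<lbrakk>acyclic_play a \<pi> g; U \<subseteq> {..<a}; \<forall>e\<in>board_edges g. e \<inter> U = {}; s \<le> card U\<rbrakk> \<Longrightarrow>
      \<exists>t v. acyclic_play a \<pi> (g @ t) \<and> (\<forall>e\<in>board_edges t. e \<subseteq> U) \<and> v \<in> U \<and> P (set (g @ t)) v"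
    and mono: "\<And>S S' v. P S v \<Longrightarrow> S \<subseteq> S' \<Longrightarrow> P S' v"
    and g: "acyclic_play a \<pi> g" and U: "U \<subseteq> {..<a}" "\<forall>e\<in>board_edges g. e \<inter> U = {}" "q * s \<le> card U"
  shows "\<exists>t X. acyclic_play a \<pi> (g @ t) \<and> (\<forall>e\<in>board_edges t. e \<subseteq> U) \<and> X \<subseteq> U \<and> card X = q \<and>
    (\<forall>x\<in>X. P (set (g @ t)) x) \<and> (\<forall>x\<in>X. \<forall>y\<in>X. x \<noteq> y \<longrightarrow> y \<notin> component (board_edges (g @ t)) x)"
  using U
proof (induction q arbitrary: U)
  case 0
  then show ?case using g by (intro exI[of _ "[]"] exI[of _ "{}"]) auto
next
  case (Suc q)
  have finU: "finite U" using Suc.prems(1) finite_subset by blast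
  obtain U1 where U1: "U1 \<subseteq> U" "card U1 = q * s"
    using obtain_subset_with_card_n[of "q * s" U] Suc.prems(3) by auto
  let ?U2 = "U - U1"
  have "card ?U2 = card U - q * s" using U1 finU by (simp add: card_Diff_subset finite_subset)
  then have U2: "s \<le> card ?U2" using Suc.prems(3) by simp
  obtain t X where t: "acyclic_play a \<pi> (g @ t)" "\<forall>e\<in>board_edges t. e \<subseteq> U1" "X \<subseteq> U1" "card X = q"
    "\<forall>x\<in>X. P (set (g @ t)) x"
    "\<forall>x\<in>X. \<forall>y\<in>X. x \<noteq> y \<longrightarrow> y \<notin> component (board_edges (g @ t)) x"
  proof -
    have "U1 \<subseteq> {..<a}" using Suc.prems(1) U1(1) by (rule order.trans[rotated])
    moreover have "\<forall>e\<in>board_edges g. e \<inter> U1 = {}" using Suc.prems(2) U1(1) by blast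
    moreover have "q * s \<le> card U1" using U1(2) by simp
    ultimately have "U1 \<subseteq> {..<a}" "\<forall>e\<in>board_edges g. e \<inter> U1 = {}" "q * s \<le> card U1" .
    from Suc.IH[OF this] show ?thesis using that by blast
  qed
  have iso2: "\<forall>e\<in>board_edges (g @ t). e \<inter> ?U2 = {}"
    using t(2) Suc.prems(2) by (auto simp: board_edges_append)
  obtain t' v where t': "acyclic_play a \<pi> ((g @ t) @ t')" "\<forall>e\<in>board_edges t'. e \<subseteq> ?U2" "v \<in> ?U2"
    "P (set ((g @ t) @ t')) v"
    using claim[OF t(1) _ iso2 U2] Suc.prems(1) by blast
  let ?B = "board_edges (g @ t)" and ?B' = "board_edges (g @ t @ t')"
  have B': "?B' = ?B \<union> board_edges t'" by (auto simp: board_edges_append)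
  have cU1: "component ?B x \<subseteq> U1" if "x \<in> U1" for x
  proof (rule component_closed_subset[OF that])
    fix y z assume y: "y \<in> U1" "{y, z} \<in> ?B"
    then consider "{y, z} \<in> board_edges g" | "{y, z} \<in> board_edges t"
      by (auto simp: board_edges_append)
    then show "z \<in> U1"
    proof cases
      case 1
      then have "y \<notin> U" using Suc.prems(2) by fastforce
      then show ?thesis using y(1) U1(1) by blast
    next
      case 2
      then show ?thesis using t(2) by fastforce
    qed
  qed
  have same: "component ?B' x = component ?B x" if "x \<in> U1" for x
    unfolding B' by (rule component_union_elsewhere[OF cU1[OF that]]) (use t'(2) in blast)
  have vX: "v \<notin> component ?B' x" if "x \<in> X" for x
    using same[of x] cU1[of x] that t(3) t'(3) by blast
  then have Xv: "x \<notin> component ?B' v" if "x \<in> X" for x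
    using that component_sym by metis
  let ?X = "insert v X"
  have "finite X" using t(3) U1(1) finU by (meson finite_subset)
  moreover have "v \<notin> X" using t(3) t'(3) by blast
  ultimately have "card ?X = Suc q" using t(4) by simp
  moreover have "\<forall>x\<in>?X. P (set (g @ t @ t')) x"
    using t'(4) t(5) mono[of "set (g @ t)" _ "set (g @ t @ t')"] by auto
  moreover have "\<forall>x\<in>?X. \<forall>y\<in>?X. x \<noteq> y \<longrightarrow> y \<notin> component ?B' x"
    using vX Xv t(6) same t(3) by (auto dest!: subsetD)
  moreover have "\<forall>e\<in>board_edges (t @ t'). e \<subseteq> U"
    using t(2) t'(2) U1(1) by (auto simp: board_edges_append)
  moreover have "?X \<subseteq> U" using t(3) t'(3) U1(1) by blast
  ultimately show ?case using t'(1)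
    by (intro exI[of _ "t @ t'"] exI[of _ ?X] conjI) (simp_all only: append_assoc)
qed

text \<open>The component of the centre absorbs one leaf after the other; the leaves still waiting
  remain in separate components, so no edge closes a cycle.\<close>

lemma force_star:
  assumes "finite Y" "acyclic_play a \<pi> g" "insert v Y \<subseteq> {..<a}" "v \<notin> Y"
    and "\<forall>z\<in>insert v Y. \<forall>w\<in>insert v Y. w \<noteq> z \<longrightarrow> w \<notin> component (board_edges g) z"
  shows "\<exists>t. acyclic_play a \<pi> (g @ t) \<and> board_edges t = (\<lambda>y. {v, y}) ` Y"
  using assms
proof (induction Y arbitrary: g rule: finite_induct)
  case empty
  then show ?case by (intro exI[of _ "[]"]) auto
next
  case (insert y Y)
  let ?B = "board_edges g"
  let ?g = "g @ [({v, y}, \<pi> g {v, y})]"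
  have vy: "y \<notin> component ?B v" using insert.prems by auto
  have g': "acyclic_play a \<pi> ?g"
    using acyclic_play_extend[OF insert.prems(1) _ _ vy] insert.prems(2) by simp
  have "\<forall>z\<in>insert v Y. \<forall>w\<in>insert v Y. w \<noteq> z \<longrightarrow> w \<notin> component (board_edges ?g) z"
  proof (intro ballI impI)
    fix z w assume zw: "z \<in> insert v Y" "w \<in> insert v Y" "w \<noteq> z"
    have same: "component (insert {v, y} ?B) x = component ?B x" if "x \<in> Y" for x
    proof (rule component_insert_other)
      show "x \<notin> component ?B v" using that insert.prems by auto
      show "x \<notin> component ?B y" using that insert.prems insert.hyps by auto
    qed
    show "w \<notin> component (board_edges ?g) z"
    proof (cases "z = v")
      case True
      then have w: "w \<in> Y" using zw by auto
      have "v \<notin> component ?B w" using w insert.prems by auto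
      then have "v \<notin> component (insert {v, y} ?B) w" using same[OF w] by simp
      then have "w \<notin> component (insert {v, y} ?B) v" using component_sym by metis
      then show ?thesis using True by simp
    next
      case False
      then have z: "z \<in> Y" using zw by auto
      have "w \<notin> component ?B z" using zw z insert.prems by auto
      then show ?thesis using same[OF z] by simp
    qed
  qed
  from insert.IH[OF g' _ _ this] insert.prems obtain t where
    "acyclic_play a \<pi> (?g @ t)" "board_edges t = (\<lambda>y. {v, y}) ` Y" by auto
  then show ?case
    by (intro exI[of _ "({v, y}, \<pi> g {v, y}) # t"]) (auto simp: board_edges_def)
qed

definition rich_in_all :: "nat \<Rightarrow> nat \<Rightarrow> (nat \<Rightarrow> nat) \<Rightarrow> (nat set \<times> nat) set \<Rightarrow> nat \<Rightarrow> bool" where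
  "rich_in_all r d \<tau> S v \<longleftrightarrow> (\<forall>c<r. rich {e. (e, c) \<in> S} d (\<tau> c) v)"

lemma rich_in_all_mono: "rich_in_all r d \<tau> S v \<Longrightarrow> S \<subseteq> S' \<Longrightarrow> rich_in_all r d \<tau> S' v"
  unfolding rich_in_all_def by (auto elim!: rich_superset)

text \<open>The number of untouched vertices that suffices for total depth \<open>m\<close>. Let
  \<open>p\<close> be the number of functions that can record the depth in each colour. Among
  \<open>d * r * p + 1\<close> blocks some \<open>d * r + 1\<close> have the same record; one
  supplies the centre of a star, the others its leaves, and \<open>d\<close> of the
  \<open>d * r\<close> edges share a colour.\<close>

fun block_size :: "nat \<Rightarrow> nat \<Rightarrow> nat \<Rightarrow> nat" where
  "block_size r d 0 = 1"
| "block_size r d (Suc m) = Suc (d * r * card ({..<r} \<rightarrow>\<^sub>E {..m})) * block_size r d m"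

text \<open>A star joining one of many equally rich vertices to all the others raises, at its centre, the
  depth in the colour that occurs most often.\<close>

lemma force_rich:
  assumes \<pi>: "painter_strategy r \<pi>" and "r > 0"
    and "acyclic_play a \<pi> g" "U \<subseteq> {..<a}" "\<forall>e\<in>board_edges g. e \<inter> U = {}" "block_size r d m \<le> card U"
  shows "\<exists>t v. acyclic_play a \<pi> (g @ t) \<and> (\<forall>e\<in>board_edges t. e \<subseteq> U) \<and> v \<in> U \<and>
    (\<exists>\<tau>\<in>{..<r} \<rightarrow>\<^sub>E {..m}. sum \<tau> {..<r} = m \<and> rich_in_all r d \<tau> (set (g @ t)) v)"
  using assms(3-)
proof (induction m arbitrary: g U)
  case 0
  then obtain v where "v \<in> U" by fastforce
  with 0 show ?case
    by (intro exI[of _ "[]"] exI[of _ v] conjI bexI[of _ "\<lambda>c\<in>{..<r}. 0"]) (auto simp: rich_in_all_def)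
next
  case (Suc m)
  let ?T = "{..<r} \<rightarrow>\<^sub>E {..m}"
  let ?P = "\<lambda>S v. \<exists>\<tau>\<in>?T. sum \<tau> {..<r} = m \<and> rich_in_all r d \<tau> S v"
  have "\<exists>t X. acyclic_play a \<pi> (g @ t) \<and> (\<forall>e\<in>board_edges t. e \<subseteq> U) \<and> X \<subseteq> U \<and>
    card X = Suc (d * r * card ?T) \<and> (\<forall>x\<in>X. ?P (set (g @ t)) x) \<and>
    (\<forall>x\<in>X. \<forall>y\<in>X. x \<noteq> y \<longrightarrow> y \<notin> component (board_edges (g @ t)) x)"
  proof (rule force_many[where s = "block_size r d m"])
    show "\<And>S S' v. ?P S v \<Longrightarrow> S \<subseteq> S' \<Longrightarrow> ?P S' v" using rich_in_all_mono by blast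
  qed (use Suc in auto)
  then obtain t X where t: "acyclic_play a \<pi> (g @ t)" "\<forall>e\<in>board_edges t. e \<subseteq> U" "X \<subseteq> U"
    "card X = Suc (d * r * card ?T)" "\<forall>x\<in>X. ?P (set (g @ t)) x"
    "\<forall>x\<in>X. \<forall>y\<in>X. x \<noteq> y \<longrightarrow> y \<notin> component (board_edges (g @ t)) x" by blast
  have finX: "finite X" using t(4) by (metis card.infinite nat.distinct(1))
  obtain \<tau> where \<tau>: "\<And>x. x \<in> X \<Longrightarrow> \<tau> x \<in> ?T \<and> sum (\<tau> x) {..<r} = m \<and>
      rich_in_all r d (\<tau> x) (set (g @ t)) x" using t(5) by metis
  have "X \<noteq> {}" using t(4) by auto
  then have "?T \<noteq> {}" using \<tau> by blast
  moreover have finT: "finite ?T" by (intro finite_PiE) auto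
  ultimately obtain \<sigma> where \<sigma>: "\<sigma> \<in> ?T" "card X \<le> card (\<tau> -` {\<sigma>} \<inter> X) * card ?T"
    using pigeonhole_card[of \<tau> X ?T] finX \<tau> by blast
  have "d * r < card (\<tau> -` {\<sigma>} \<inter> X)"
  proof (rule ccontr)
    assume "\<not> d * r < card (\<tau> -` {\<sigma>} \<inter> X)"
    then have "card (\<tau> -` {\<sigma>} \<inter> X) * card ?T \<le> d * r * card ?T" by (intro mult_right_mono) auto
    then show False using \<sigma>(2) t(4) by linarith
  qed
  then obtain X' where X': "X' \<subseteq> \<tau> -` {\<sigma>} \<inter> X" "card X' = Suc (d * r)"
    using obtain_subset_with_card_n[of "Suc (d * r)" "\<tau> -` {\<sigma>} \<inter> X"]
    by (metis Suc_leI)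
  obtain v Y where v: "X' = insert v Y" "v \<notin> Y" "card Y = d * r"
    using X'(2) by (metis card_Suc_eq)
  have finY: "finite Y" using v(1) X'(1) finX by (metis finite_Int finite_subset finite_insert)
  have rich0: "rich_in_all r d \<sigma> (set (g @ t)) x" if "x \<in> insert v Y" for x
  proof -
    have "x \<in> X" "\<tau> x = \<sigma>" using X'(1) v(1) that by auto
    then show ?thesis using \<tau>[of x] by simp
  qed
  have XU: "insert v Y \<subseteq> U" "insert v Y \<subseteq> X" using X'(1) v(1) t(3) by auto
  obtain t' where t': "acyclic_play a \<pi> ((g @ t) @ t')" "board_edges t' = (\<lambda>y. {v, y}) ` Y"
  proof -
    have ia: "insert v Y \<subseteq> {..<a}" using XU(1) Suc.prems(2) by (rule order.trans)
    have sep: "\<forall>z\<in>insert v Y. \<forall>w\<in>insert v Y. w \<noteq> z \<longrightarrow>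
        w \<notin> component (board_edges (g @ t)) z"
      using t(6) XU(2) by (metis subsetD)
    from force_star[OF finY t(1) ia v(2) sep] that show ?thesis by blast
  qed
  let ?S = "set (g @ t @ t')"
  have "\<exists>c<r. ({v, y}, c) \<in> ?S" if "y \<in> Y" for y
  proof -
    have "{v, y} \<in> board_edges ((g @ t) @ t')" using t'(2) that by (auto simp: board_edges_append)
    then obtain i where i: "i < length ((g @ t) @ t')" "fst (((g @ t) @ t') ! i) = {v, y}"
      unfolding board_edges_def by (metis (no_types, lifting) imageE in_set_conv_nth)
    then have "snd (((g @ t) @ t') ! i) < r"
      using t'(1) \<pi> by (simp add: acyclic_play_def painter_follows_def painter_strategy_def)
    moreover have "({v, y}, snd (((g @ t) @ t') ! i)) \<in> set ((g @ t) @ t')"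
      using nth_mem[OF i(1)] i(2) by (metis prod.collapse)
    ultimately show ?thesis by auto
  qed
  then obtain col where col: "\<And>y. y \<in> Y \<Longrightarrow> col y < r \<and> ({v, y}, col y) \<in> ?S" by metis
  obtain c where c: "c < r" "d * r \<le> card (col -` {c} \<inter> Y) * r"
    using pigeonhole_card[of col Y "{..<r}"] finY col \<open>r > 0\<close> v(3) by auto
  let ?W = "col -` {c} \<inter> Y"
  have W: "d \<le> card ?W" using c(2) \<open>r > 0\<close> by simp
  have richer': "rich_in_all r d \<sigma> ?S x" if "x \<in> insert v Y" for x
    using rich_in_all_mono[OF rich0[OF that], of ?S] by auto
  \<comment> \<open>Centre and leaves have the same depth in colour \<open>c\<close>, so
    \<open>d\<close> leaves joined in \<open>c\<close> raise the centre by one level; its depths in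
    the other colours persist.\<close>
  let ?\<tau> = "\<sigma>(c := Suc (\<sigma> c))"
  have "rich {e. (e, c) \<in> ?S} d (Suc (\<sigma> c)) v"
    unfolding rich.simps
  proof (intro exI[of _ ?W] conjI ballI)
    fix w assume w: "w \<in> ?W"
    show "{v, w} \<in> {e. (e, c) \<in> ?S}" using col[of w] w by auto
    show "rich {e. (e, c) \<in> ?S} d (\<sigma> c) w"
      using richer'[of w] w c(1) by (auto simp: rich_in_all_def)
  qed (use W finY in auto)
  then have "rich_in_all r d ?\<tau> ?S v"
    using richer'[of v] by (auto simp: rich_in_all_def)
  moreover have \<sigma>m: "sum \<sigma> {..<r} = m" using \<tau>[of v] X'(1) v(1) by auto
  moreover have "sum ?\<tau> {..<r} = Suc (sum \<sigma> {..<r})"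
    using c(1) by (simp add: sum.remove[of "{..<r}" c])
  moreover have "?\<tau> \<in> {..<r} \<rightarrow>\<^sub>E {..Suc m}"
    using \<sigma>(1) c(1) by (auto simp: PiE_iff extensional_def intro: le_SucI)
  ultimately have "\<exists>\<tau>\<in>{..<r} \<rightarrow>\<^sub>E {..Suc m}. sum \<tau> {..<r} = Suc m \<and> rich_in_all r d \<tau> ?S v"
    by (intro bexI[of _ ?\<tau>]) auto
  moreover have "\<forall>e\<in>board_edges (t @ t'). e \<subseteq> U"
    using t(2) t'(2) XU by (auto simp: board_edges_append)
  ultimately show ?case using t'(1) XU(1)
    by (intro exI[of _ "t @ t'"] exI[of _ v]) simp
qed

text \<open>By determinacy it is enough to refute a Painter strategy that never loses on one
  suitable board. Total depth \<open>r * Suc d\<close> over \<open>r\<close> colours gives some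
  colour depth \<open>d + 1\<close>, which has room for a forest on \<open>d\<close>
  vertices.\<close>

lemma builder_wins_exists:
  assumes "forest V E" "r > 0"
  shows "\<exists>k. builder_wins V E r k"
proof (rule ccontr)
  assume n: "\<not> (\<exists>k. builder_wins V E r k)"
  define d where "d = card V"
  define m where "m = r * Suc d"
  define a where "a = block_size r d m"
  let ?k = "card (all_edges {..<a})"
  have "\<not> force V E r a ?k ?k []" using n force_imp_builder_wins by blast
  from not_force_imp_painter[OF this assms(2)] obtain \<pi> where \<pi>: "painter_strategy r \<pi>"
    "\<And>h. acyclic_play a \<pi> h \<Longrightarrow> \<not> mono_copy V E a h" by (auto simp: acyclic_play_def)
  have "acyclic_play a \<pi> []" by (simp add: acyclic_play_def)
  from force_rich[OF \<pi>(1) assms(2) this, of "{..<a}" d m] obtain h v \<tau> where h: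
    "acyclic_play a \<pi> h" "sum \<tau> {..<r} = m" "rich_in_all r d \<tau> (set h) v" by (auto simp: a_def)
  have "\<exists>c<r. Suc d \<le> \<tau> c"
  proof (rule ccontr)
    assume "\<not> (\<exists>c<r. Suc d \<le> \<tau> c)"
    then have "sum \<tau> {..<r} < (\<Sum>c<r. Suc d)" using assms(2) by (intro sum_strict_mono) auto
    then show False using h(2) by (simp add: m_def)
  qed
  then obtain c where c: "c < r" "Suc d \<le> \<tau> c" by blast
  let ?D = "{e. (e, c) \<in> set h}"
  have "rich ?D d (Suc d) v" using h(3) c rich_le unfolding rich_in_all_def by blast
  moreover have "?D \<subseteq> all_edges {..<a}"
    using h(1) legal_play_edges[of a ?k h] by (auto simp: acyclic_play_def board_edges_def image_def)
  ultimately have "contains_copy {..<a} ?D V E"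
    using rich_embeds_forest[OF assms(1), of d d ?D a v] by (auto simp: contains_copy_def d_def)
  then show False using \<pi>(2)[OF h(1)] by (auto simp: mono_copy_def)
qed

section \<open>The random game from an arbitrary position\<close>

definition game_step :: "nat \<Rightarrow> painter \<Rightarrow> history \<Rightarrow> history pmf" where
  "game_step n \<sigma> h = (let S = all_edges {..<n} - board_edges h in
     if S = {} then return_pmf h else map_pmf (\<lambda>e. h @ [(e, \<sigma> h e)]) (pmf_of_set S))"

text \<open>An arbitrary starting history makes it possible to condition on the position reached
  after each round.\<close>

primrec game_from :: "nat \<Rightarrow> painter \<Rightarrow> history \<Rightarrow> nat \<Rightarrow> history pmf" where
  "game_from n \<sigma> h 0 = return_pmf h"
| "game_from n \<sigma> h (Suc t) = bind_pmf (game_from n \<sigma> h t) (game_step n \<sigma>)"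

lemma random_game_eq: "random_game n \<sigma> N = game_from n \<sigma> [] N"
  by (induction N) (simp_all add: game_step_def[abs_def])

lemma game_from_add:
  "game_from n \<sigma> h (s + t) = bind_pmf (game_from n \<sigma> h s) (\<lambda>h'. game_from n \<sigma> h' t)"
  by (induction t) (simp_all add: bind_return_pmf' bind_assoc_pmf)

text \<open>Splitting off the first step instead of the last suits inductions in which the starting
  history varies.\<close>

lemma game_from_Suc_left:
  "game_from n \<sigma> h (Suc t) = bind_pmf (game_step n \<sigma> h) (\<lambda>h'. game_from n \<sigma> h' t)"
  using game_from_add[of n \<sigma> h 1 t] by (simp add: bind_return_pmf)

lemma game_step_cases:
  assumes "h' \<in> set_pmf (game_step n \<sigma> h)"
  shows "h' = h \<or> (\<exists>e \<in> all_edges {..<n} - board_edges h. h' = h @ [(e, \<sigma> h e)])"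
  using assms by (auto simp: game_step_def Let_def split: if_splits)

lemma game_from_invariant:
  assumes "h' \<in> set_pmf (game_from n \<sigma> h t)" "P h"
    and "\<And>g e. P g \<Longrightarrow> e \<in> all_edges {..<n} - board_edges g \<Longrightarrow> P (g @ [(e, \<sigma> g e)])"
  shows "P h'"
  using assms(1)
proof (induction t arbitrary: h')
  case 0
  then show ?case using assms(2) by simp
next
  case (Suc t)
  then obtain g where g: "g \<in> set_pmf (game_from n \<sigma> h t)" "h' \<in> set_pmf (game_step n \<sigma> g)" by auto
  then show ?case using game_step_cases[OF g(2)] Suc.IH[OF g(1)] assms(3)[of g] by blast
qed

lemma game_from_extends: "h' \<in> set_pmf (game_from n \<sigma> h t) \<Longrightarrow> set h \<subseteq> set h'"
  by (rule game_from_invariant[where P = "\<lambda>g. set h \<subseteq> set g"]) auto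

lemma game_from_colours:
  assumes "h' \<in> set_pmf (game_from n \<sigma> h t)" "painter_strategy r \<sigma>" "snd ` set h \<subseteq> {..<r}"
  shows "snd ` set h' \<subseteq> {..<r}"
  by (rule game_from_invariant[OF assms(1)]) (use assms(2,3) in \<open>auto simp: painter_strategy_def\<close>)

lemma measure_bind_pmf:
  "measure (measure_pmf (bind_pmf p f)) A = (\<integral>x. measure (measure_pmf (f x)) A \<partial>measure_pmf p)"
proof -
  have "ennreal (measure (measure_pmf (bind_pmf p f)) A) =
      (\<integral>\<^sup>+x. ennreal (measure (measure_pmf (f x)) A) \<partial>measure_pmf p)"
    unfolding measure_pmf.emeasure_eq_measure[symmetric] by (rule emeasure_bind_pmf)
  also have "\<dots> = ennreal (\<integral>x. measure (measure_pmf (f x)) A \<partial>measure_pmf p)"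
    by (intro nn_integral_eq_integral measure_pmf.integrable_const_bound[where B = 1]) auto
  finally show ?thesis by (simp add: integral_nonneg_AE)
qed

text \<open>This adds up the failure probabilities of consecutive rounds.\<close>

lemma measure_bind_pmf_le:
  assumes "\<And>x. x \<in> set_pmf p \<Longrightarrow> x \<notin> Bad \<Longrightarrow> measure (measure_pmf (f x)) A \<le> \<epsilon>" "0 \<le> \<epsilon>"
  shows "measure (measure_pmf (bind_pmf p f)) A \<le> measure (measure_pmf p) Bad + \<epsilon>"
proof -
  have "(\<integral>x. measure (measure_pmf (f x)) A \<partial>measure_pmf p) \<le>
      (\<integral>x. indicator Bad x + \<epsilon> \<partial>measure_pmf p)"
  proof (rule integral_mono_AE)
    show "integrable (measure_pmf p) (\<lambda>x. measure (measure_pmf (f x)) A)"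
      by (rule measure_pmf.integrable_const_bound[where B = 1]) auto
    show "integrable (measure_pmf p) (\<lambda>x. indicator Bad x + \<epsilon>)"
      by (intro Bochner_Integration.integrable_add) (auto simp: measure_pmf.emeasure_eq_measure)
    show "AE x in measure_pmf p. measure (measure_pmf (f x)) A \<le> indicator Bad x + \<epsilon>"
      using assms by (auto simp: AE_measure_pmf_iff indicator_def
          intro: order.trans[OF measure_pmf.prob_le_1])
  qed
  also have "\<dots> = measure (measure_pmf p) Bad + \<epsilon>"
    by (subst Bochner_Integration.integral_add)
      (auto simp: measure_pmf.emeasure_eq_measure)
  finally show ?thesis by (simp add: measure_bind_pmf)
qed

lemma measure_bind_game_step:
  assumes "S = all_edges {..<n} - board_edges h" "S \<noteq> {}"
  shows "measure (measure_pmf (bind_pmf (game_step n \<sigma> h) f)) A =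
    (\<Sum>e\<in>S. measure (measure_pmf (f (h @ [(e, \<sigma> h e)]))) A) / card S"
proof -
  have "finite S" using assms by simp
  then show ?thesis using assms
    by (simp add: game_step_def Let_def bind_map_pmf measure_bind_pmf integral_pmf_of_set)
qed

lemma measure_pmf_eq_0I: "(\<And>x. x \<in> set_pmf p \<Longrightarrow> x \<notin> A) \<Longrightarrow> measure (measure_pmf p) A = 0"
  by (auto simp: measure_pmf_zero_iff)

section \<open>Matchings in the random game\<close>

definition has_matching :: "nat set \<Rightarrow> nat set \<Rightarrow> nat set set \<Rightarrow> nat \<Rightarrow> bool" where
  "has_matching P Q B j \<longleftrightarrow> (\<exists>X f. X \<subseteq> P \<and> card X = j \<and> inj_on f X \<and> f ` X \<subseteq> Q \<and>
     (\<forall>p\<in>X. {p, f p} \<in> B))"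

lemma has_matching_0: "has_matching P Q B 0"
  unfolding has_matching_def by (rule exI[of _ "{}"]) auto

lemma has_matching_mono: "has_matching P Q B j \<Longrightarrow> B \<subseteq> B' \<Longrightarrow> has_matching P Q B' j"
  unfolding has_matching_def by blast

lemma has_matching_le:
  assumes "has_matching P Q B j" "i \<le> j" shows "has_matching P Q B i"
proof -
  obtain X f where X: "X \<subseteq> P" "card X = j" "inj_on f X" "f ` X \<subseteq> Q" "\<forall>p\<in>X. {p, f p} \<in> B"
    using assms(1) unfolding has_matching_def by blast
  obtain Y where "Y \<subseteq> X" "card Y = i" using obtain_subset_with_card_n[of i X] X(2) assms(2) by auto
  then show ?thesis unfolding has_matching_def using X
    by (intro exI[of _ Y] exI[of _ f]) (auto intro: inj_on_subset)
qed

lemma card_all_edges_le: "card (all_edges {..<n}) \<le> n * n"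
proof -
  have "all_edges {..<n} \<subseteq> (\<lambda>(x, y). {x, y}) ` ({..<n} \<times> {..<n})"
    by (auto elim!: all_edges_obtain)
  then have "card (all_edges {..<n}) \<le> card ({..<n} \<times> {..<n})"
    by (meson card_image_le card_mono finite_SigmaI finite_imageI finite_lessThan le_trans)
  then show ?thesis by simp
qed

lemma card_complete_bipartite:
  assumes "P \<inter> Q = {}"
  shows "card ((\<lambda>(p, q). {p, q}) ` (P \<times> Q)) = card P * card Q"
proof -
  have "inj_on (\<lambda>(p, q). {p, q}) (P \<times> Q)"
    using assms by (auto simp: inj_on_def doubleton_eq_iff)
  then show ?thesis by (simp add: card_image card_cartesian_product)
qed

text \<open>An edge joining two vertices that a maximum matching misses is not on the board, and drawing
  it enlarges the matching. So \<open>2\<close> to the minus matching size is a supermartingale.\<close>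

lemma no_matching_prob:
  assumes PQ: "P \<subseteq> {..<n}" "Q \<subseteq> {..<n}" "P \<inter> Q = {}" and s: "s \<le> card P" "s \<le> card Q"
    and \<rho>: "\<rho> = real ((card P - s) * (card Q - s)) / real (n * n)"
    and "has_matching P Q (board_edges h) j" "j \<le> s"
  shows "measure (measure_pmf (game_from n \<sigma> h t)) {h'. \<not> has_matching P Q (board_edges h') s}
    \<le> 2 ^ (s - j) * (1 - \<rho> / 2) ^ t"
  using assms(7,8)
proof (induction t arbitrary: h j)
  case 0
  have "1 \<le> (2::real) ^ (s - j)" by simp
  then show ?case using measure_pmf.prob_le_1 order.trans by (simp, blast)
next
  case (Suc t)
  let ?F = "{h'. \<not> has_matching P Q (board_edges h') s}"
  have fin: "finite P" "finite Q" using PQ finite_subset by blast+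
  have cP: "card P \<le> n" "card Q \<le> n" using PQ card_mono[of "{..<n}"] by fastforce+
  have "(card P - s) * (card Q - s) \<le> n * n" using cP by (intro mult_mono) auto
  then have \<rho>1: "0 \<le> \<rho>" "\<rho> \<le> 1" unfolding \<rho> by (auto simp: divide_le_eq_1 simp flip: of_nat_mult)
  have "\<forall>i. has_matching P Q (board_edges h) i \<longrightarrow> i < Suc (card P)"
    unfolding has_matching_def using fin(1) by (auto simp: less_Suc_eq_le intro: card_mono)
  \<comment> \<open>The induction allows any known size \<open>j\<close>, but the step needs a
    maximum matching: only then is no edge between missed vertices on the board yet.\<close>
  then obtain i where i: "has_matching P Q (board_edges h) i"
    "\<And>i'. has_matching P Q (board_edges h) i' \<Longrightarrow> i' \<le> i"
    using ex_has_greatest_nat[of "has_matching P Q (board_edges h)" j id "Suc (card P)"] Suc.prems(1)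
    by auto
  show ?case
  proof (cases "s \<le> i")
    case True
    have "has_matching P Q (board_edges h') s" if "h' \<in> set_pmf (game_from n \<sigma> h (Suc t))" for h'
      by (rule has_matching_mono[OF has_matching_le[OF i(1) True]])
        (use game_from_extends[OF that] in \<open>auto simp: board_edges_def\<close>)
    then have "measure (measure_pmf (game_from n \<sigma> h (Suc t))) ?F = 0"
      by (intro measure_pmf_eq_0I) auto
    also have "0 \<le> 2 ^ (s - j) * (1 - \<rho> / 2) ^ Suc t" using \<rho>1 by simp
    finally show ?thesis .
  next
    case False
    obtain X f where X: "X \<subseteq> P" "card X = i" "inj_on f X" "f ` X \<subseteq> Q"
      "\<forall>p\<in>X. {p, f p} \<in> board_edges h"
      using i(1) unfolding has_matching_def by blast
    have finX: "finite X" using X(1) fin(1) finite_subset by blast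
    define G where "G = (\<lambda>(p, q). {p, q}) ` ((P - X) \<times> (Q - f ` X))"
    define S where "S = all_edges {..<n} - board_edges h"
    define w where "w = 2 ^ (s - i) * (1 - \<rho> / 2) ^ t"
    have w0: "0 \<le> w" using \<rho>1 by (simp add: w_def)
    have ext: "has_matching P Q (insert e (board_edges h)) (Suc i)" if e: "e \<in> G" for e
    proof -
      obtain p q where pq: "p \<in> P - X" "q \<in> Q - f ` X" "e = {p, q}"
        using e by (auto simp: G_def)
      show ?thesis unfolding has_matching_def
        by (rule exI[of _ "insert p X"], rule exI[of _ "f(p := q)"])
          (use pq X finX in \<open>auto simp: inj_on_def\<close>)
    qed
    have GS: "G \<subseteq> S"
    proof
      fix e assume e: "e \<in> G"
      have "e \<notin> board_edges h" using ext[OF e] i(2)[of "Suc i"] by (auto simp: insert_absorb)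
      moreover have "e \<in> all_edges {..<n}" using e PQ by (auto simp: G_def)
      ultimately show "e \<in> S" by (simp add: S_def)
    qed
    have cG: "card G = (card P - i) * (card Q - i)"
      using card_complete_bipartite[of "P - X" "Q - f ` X"] PQ(3) X fin finX
      by (auto simp: G_def card_Diff_subset card_image)
    have "(card P - s) * (card Q - s) \<le> card G"
      unfolding cG using False by (intro mult_mono) auto
    moreover have "0 < card G" unfolding cG using False s by auto
    moreover have "card S \<le> n * n"
      using card_all_edges_le[of n] card_mono[of "all_edges {..<n}" S] by (auto simp: S_def)
    moreover have finS: "finite S" by (simp add: S_def)
    moreover have "S \<noteq> {}" using GS \<open>0 < card G\<close> by auto
    moreover have cS: "0 < card S" using finS \<open>S \<noteq> {}\<close> by (simp add: card_gt_0_iff)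
    ultimately have \<rho>le: "\<rho> \<le> real (card G) / real (card S)"
      unfolding \<rho> by (intro frac_le) (auto simp flip: of_nat_mult)
    have "measure (measure_pmf (game_from n \<sigma> h (Suc t))) ?F =
        (\<Sum>e\<in>S. measure (measure_pmf (game_from n \<sigma> (h @ [(e, \<sigma> h e)]) t)) ?F) / card S"
      unfolding game_from_Suc_left by (rule measure_bind_game_step[OF S_def \<open>S \<noteq> {}\<close>])
    \<comment> \<open>An edge in \<open>G\<close> enlarges the matching and halves the bound; any
      other edge leaves the matching intact. As \<open>G\<close> has density at least
      \<open>\<rho>\<close> in \<open>S\<close>, the average factor is at most
      \<open>1 - \<rho> / 2\<close>.\<close>
    also have "\<dots> \<le> (\<Sum>e\<in>S. if e \<in> G then w / 2 else w) / card S"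
    proof (intro divide_right_mono sum_mono)
      fix e assume e: "e \<in> S"
      show "measure (measure_pmf (game_from n \<sigma> (h @ [(e, \<sigma> h e)]) t)) ?F \<le>
          (if e \<in> G then w / 2 else w)"
      proof (cases "e \<in> G")
        case True
        have "measure (measure_pmf (game_from n \<sigma> (h @ [(e, \<sigma> h e)]) t)) ?F \<le>
            2 ^ (s - Suc i) * (1 - \<rho> / 2) ^ t"
          by (rule Suc.IH) (use ext[OF True] False in auto)
        moreover have "s - i = Suc (s - Suc i)" using False by simp
        ultimately show ?thesis using True by (simp add: w_def)
      next
        case False
        have "measure (measure_pmf (game_from n \<sigma> (h @ [(e, \<sigma> h e)]) t)) ?F \<le>
            2 ^ (s - i) * (1 - \<rho> / 2) ^ t"
          by (rule Suc.IH) (use has_matching_mono[OF i(1)] \<open>\<not> s \<le> i\<close> in auto)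
        then show ?thesis using False by (simp add: w_def)
      qed
    qed simp
    also have "(\<Sum>e\<in>S. if e \<in> G then w / 2 else w) = (\<Sum>e\<in>S. w - (if e \<in> G then w / 2 else 0))"
      by (rule sum.cong) auto
    also have "\<dots> = card S * w - card G * (w / 2)"
      using finS GS by (simp add: sum_subtractf sum.If_cases Int_absorb1)
    also have "(card S * w - card G * (w / 2)) / card S = w * (1 - (card G / card S) / 2)"
      using cS by (simp add: field_simps)
    also have "\<dots> \<le> w * (1 - \<rho> / 2)" using \<rho>le w0 by (intro mult_left_mono) auto
    also have "\<dots> = 2 ^ (s - i) * (1 - \<rho> / 2) ^ Suc t" by (simp add: w_def)
    also have "\<dots> \<le> 2 ^ (s - j) * (1 - \<rho> / 2) ^ Suc t"
    proof (intro mult_right_mono power_increasing)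
      show "s - i \<le> s - j" using i(2)[OF Suc.prems(1)] by simp
    qed (use \<rho>1 in auto)
    finally show ?thesis .
  qed
qed

text \<open>With \<open>s\<close> at most half of either side, \<open>\<rho>\<close> is at least |P|
  |Q| / (4 n^2), hence \<open>\<rho> * m \<ge> z\<close>. Replacing 2 by e yields the exponent s -
  \<rho> m / 2, which is at most z/4 - z/2.\<close>

lemma no_matching_prob_exp:
  assumes PQ: "P \<subseteq> {..<n}" "Q \<subseteq> {..<n}" "P \<inter> Q = {}"
    and s: "2 * s \<le> card P" "2 * s \<le> card Q"
    and z: "z \<le> real (card P) * real (card Q) / (4 * real n * real n) * real m" "real s \<le> z / 4"
  shows "measure (measure_pmf (game_from n \<sigma> h m)) {h'. \<not> has_matching P Q (board_edges h') s}
    \<le> exp (- (z / 4))"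
proof -
  define \<rho> where "\<rho> = real ((card P - s) * (card Q - s)) / real (n * n)"
  have cP: "card P \<le> n" "card Q \<le> n" using PQ card_mono[of "{..<n}"] by fastforce+
  have "(card P - s) * (card Q - s) \<le> n * n" using cP by (intro mult_mono) auto
  then have \<rho>1: "0 \<le> \<rho>" "\<rho> \<le> 1" unfolding \<rho>_def by (auto simp: divide_le_eq_1 simp flip: of_nat_mult)
  have "real (card P) / 2 * (real (card Q) / 2) \<le> real (card P - s) * real (card Q - s)"
    using s by (intro mult_mono) auto
  then have "real (card P) * real (card Q) / (4 * real n * real n) \<le> \<rho>"
    using divide_right_mono[of "real (card P) / 2 * (real (card Q) / 2)" _ "real (n * n)"]
    by (simp add: \<rho>_def field_simps)
  then have "real (card P) * real (card Q) / (4 * real n * real n) * real m \<le> \<rho> * real m"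
    by (rule mult_right_mono) simp
  then have z\<rho>: "z \<le> \<rho> * real m" using z(1) by linarith
  have "measure (measure_pmf (game_from n \<sigma> h m)) {h'. \<not> has_matching P Q (board_edges h') s}
      \<le> 2 ^ (s - 0) * (1 - \<rho> / 2) ^ m"
    by (rule no_matching_prob[OF PQ]) (use s \<rho>_def has_matching_0 in auto)
  also have "\<dots> \<le> exp 1 ^ s * exp (- \<rho> / 2) ^ m"
    using exp_ge_add_one_self[of "- \<rho> / 2"] exp_ge_add_one_self[of 1] \<rho>1
    by (intro mult_mono power_mono) (auto simp: power_mono)
  also have "\<dots> = exp (real s - \<rho> * real m / 2)"
    by (simp add: exp_of_nat_mult[symmetric] exp_add[symmetric] mult_ac)
  also have "\<dots> \<le> exp (- (z / 4))" using z\<rho> z(2) by (auto simp: exp_le_cancel_iff)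
  finally show ?thesis .
qed

section \<open>Disjoint copies of coloured components\<close>

text \<open>Injectivity on all pairs \<open>(i, v)\<close> says at once that each
  \<open>\<phi> i\<close> is injective and that different copies share no vertex.\<close>

definition copy_family ::
    "nat \<Rightarrow> history \<Rightarrow> (nat set \<times> nat) set \<Rightarrow> nat set \<Rightarrow> nat set \<Rightarrow> (nat \<Rightarrow> nat \<Rightarrow> nat) \<Rightarrow> bool" where
  "copy_family n h K C I \<phi> \<longleftrightarrow> finite I \<and> inj_on (\<lambda>(i, v). \<phi> i v) (I \<times> C) \<and>
     (\<forall>i\<in>I. \<phi> i ` C \<subseteq> {..<n} \<and> (\<forall>(e, c)\<in>K. (\<phi> i ` e, c) \<in> set h))"

lemma copy_family_inj:
  "copy_family n h K C I \<phi> \<Longrightarrow> i \<in> I \<Longrightarrow> j \<in> I \<Longrightarrow> v \<in> C \<Longrightarrow> w \<in> C \<Longrightarrow> \<phi> i v = \<phi> j w \<Longrightarrow> i = j \<and> v = w"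
  unfolding copy_family_def inj_on_def by auto

lemma copy_family_subset: "copy_family n h K C I \<phi> \<Longrightarrow> I' \<subseteq> I \<Longrightarrow> copy_family n h K C I' \<phi>"
  unfolding copy_family_def
  by (auto intro: finite_subset elim!: inj_on_subset)

lemma copy_family_extend: "copy_family n h K C I \<phi> \<Longrightarrow> set h \<subseteq> set h' \<Longrightarrow> copy_family n h' K C I \<phi>"
  unfolding copy_family_def by fast

lemma copy_family_range: "copy_family n h K C I \<phi> \<Longrightarrow> i \<in> I \<Longrightarrow> v \<in> C \<Longrightarrow> \<phi> i v < n"
  unfolding copy_family_def by fast

lemma copy_family_antimono: "copy_family n h K C I \<phi> \<Longrightarrow> K' \<subseteq> K \<Longrightarrow> copy_family n h K' C I \<phi>"
  unfolding copy_family_def by fast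

text \<open>The copies are disjoint, so each vertex of \<open>Z\<close> lies in at most one of
  them.\<close>

lemma card_hit_copies:
  assumes fam: "copy_family n h K C J \<psi>" and "finite Z"
  shows "card {j \<in> J. \<psi> j ` C \<inter> Z \<noteq> {}} \<le> card Z"
proof -
  let ?H = "{j \<in> J. \<psi> j ` C \<inter> Z \<noteq> {}}"
  have "\<forall>j\<in>?H. \<exists>v\<in>C. \<psi> j v \<in> Z" by auto
  then obtain v where v: "\<And>j. j \<in> ?H \<Longrightarrow> v j \<in> C \<and> \<psi> j (v j) \<in> Z" by metis
  have "inj_on (\<lambda>j. \<psi> j (v j)) ?H"
    by (rule inj_onI) (use v copy_family_inj[OF fam] in blast)
  moreover have "(\<lambda>j. \<psi> j (v j)) ` ?H \<subseteq> Z" using v by blast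
  ultimately show ?thesis using card_inj_on_le assms(2) by blast
qed

text \<open>The first family occupies at most \<open>card I * card C\<close> vertices, each of which
  spoils at most one copy of the second.\<close>

lemma separate_families:
  assumes I: "copy_family n h K C I \<phi>" and J: "copy_family n h K' C' J \<psi>" and "finite C"
  shows "\<exists>J'\<subseteq>J. card J \<le> card J' + card I * card C \<and>
    (\<forall>i\<in>I. \<forall>j\<in>J'. \<phi> i ` C \<inter> \<psi> j ` C' = {})"
proof -
  let ?Z = "(\<lambda>(i, v). \<phi> i v) ` (I \<times> C)"
  let ?H = "{j \<in> J. \<psi> j ` C' \<inter> ?Z \<noteq> {}}"
  have fin: "finite I" "finite J" using I J by (auto simp: copy_family_def)
  have "card ?H \<le> card ?Z" by (rule card_hit_copies[OF J]) (use fin assms(3) in auto)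
  also have "\<dots> \<le> card (I \<times> C)" by (rule card_image_le) (use fin assms(3) in auto)
  also have "\<dots> = card I * card C" by (simp add: card_cartesian_product)
  finally have "card J \<le> card (J - ?H) + card I * card C"
    using card_Diff_subset[of ?H J] fin(2) by auto
  then show ?thesis by (intro exI[of _ "J - ?H"]) force
qed

text \<open>Each matching edge ties a copy of the first family to one of the second at the images of
  \<open>u\<close> and \<open>v\<close>, and the merged copies are disjoint because matching edges
  are. Painter may colour these edges at will; keeping a most frequent colour loses only the factor
  \<open>r\<close>.\<close>

lemma merge_families:
  assumes I: "copy_family n h K C I \<phi>" and J: "copy_family n h K' C' J \<psi>"
    and sep: "\<And>i j. i \<in> I \<Longrightarrow> j \<in> J \<Longrightarrow> \<phi> i ` C \<inter> \<psi> j ` C' = {}"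
    and "u \<in> C" "v \<in> C'" "C \<inter> C' = {}"
    and K: "\<And>e c. (e, c) \<in> K \<Longrightarrow> e \<subseteq> C" "\<And>e c. (e, c) \<in> K' \<Longrightarrow> e \<subseteq> C'"
    and match: "has_matching ((\<lambda>i. \<phi> i u) ` I) ((\<lambda>j. \<psi> j v) ` J) (board_edges h') s"
    and h': "set h \<subseteq> set h'" "snd ` set h' \<subseteq> {..<r}" "r > 0"
  shows "\<exists>c<r. \<exists>I' \<theta>. copy_family n h' (insert ({u, v}, c) (K \<union> K')) (C \<union> C') I' \<theta> \<and> s \<le> card I' * r"
proof -
  let ?P = "(\<lambda>i. \<phi> i u) ` I" and ?Q = "(\<lambda>j. \<psi> j v) ` J"
  obtain X f where X: "X \<subseteq> ?P" "card X = s" "inj_on f X" "f ` X \<subseteq> ?Q"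
    "\<And>p. p \<in> X \<Longrightarrow> {p, f p} \<in> board_edges h'"
    using match unfolding has_matching_def by blast
  have finX: "finite X" using X(1) I by (meson copy_family_def finite_imageI finite_subset)
  have "\<forall>p\<in>X. \<exists>i\<in>I. \<phi> i u = p" using X(1) by blast
  then obtain \<iota> where \<iota>: "\<And>p. p \<in> X \<Longrightarrow> \<iota> p \<in> I \<and> \<phi> (\<iota> p) u = p" by metis
  have "\<forall>p\<in>X. \<exists>j\<in>J. \<psi> j v = f p" using X(4) by (metis (no_types, lifting) imageE image_subset_iff)
  then obtain \<kappa> where \<kappa>: "\<And>p. p \<in> X \<Longrightarrow> \<kappa> p \<in> J \<and> \<psi> (\<kappa> p) v = f p" by metis
  have "\<exists>c<r. ({p, f p}, c) \<in> set h'" if "p \<in> X" for p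
    using X(5)[OF that] h'(2) by (fastforce simp: board_edges_def)
  then obtain col where col: "\<And>p. p \<in> X \<Longrightarrow> col p < r \<and> ({p, f p}, col p) \<in> set h'" by metis
  obtain c where c: "c < r" "s \<le> card (col -` {c} \<inter> X) * r"
    using pigeonhole_card[of col X "{..<r}"] finX col h'(3) X(2) by auto
  let ?I = "col -` {c} \<inter> X"
  \<comment> \<open>Vertices are numbers, so the matched vertices \<open>p\<close> themselves index
    the merged copies.\<close>
  define \<theta> where "\<theta> p w = (if w \<in> C then \<phi> (\<iota> p) w else \<psi> (\<kappa> p) w)" for p w
  have \<theta>C: "\<theta> p ` e = \<phi> (\<iota> p) ` e" if "e \<subseteq> C" for p e
    using that by (auto simp: \<theta>_def intro!: image_cong)
  have \<theta>C': "\<theta> p ` e = \<psi> (\<kappa> p) ` e" if "e \<subseteq> C'" for p e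
    using that assms(6) by (intro image_cong) (auto simp: \<theta>_def)
  have \<phi>\<psi>: "\<phi> (\<iota> p) w \<noteq> \<psi> (\<kappa> q) w'" if "p \<in> X" "q \<in> X" "w \<in> C" "w' \<in> C'" for p q w w'
    using sep[of "\<iota> p" "\<kappa> q"] \<iota>[OF that(1)] \<kappa>[OF that(2)] that by blast
  have "inj_on (\<lambda>(p, w). \<theta> p w) (?I \<times> (C \<union> C'))"
  proof (rule inj_onI, clarify)
    fix p w q w' assume pq: "p \<in> X" "q \<in> X" and w: "w \<in> C \<union> C'" "w' \<in> C \<union> C'" and eq: "\<theta> p w = \<theta> q w'"
    consider "w \<in> C" "w' \<in> C" | "w \<notin> C" "w \<in> C'" "w' \<notin> C" "w' \<in> C'"
      | "w \<in> C" "w' \<notin> C" "w' \<in> C'" | "w' \<in> C" "w \<notin> C" "w \<in> C'" using w by blast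
    then show "p = q \<and> w = w'"
    proof cases
      case 1
      then have "\<phi> (\<iota> p) w = \<phi> (\<iota> q) w'" using eq by (simp add: \<theta>_def)
      then have "\<iota> p = \<iota> q \<and> w = w'" using copy_family_inj[OF I] \<iota> pq 1 by blast
      then show ?thesis using \<iota> pq by metis
    next
      case 2
      then have "\<psi> (\<kappa> p) w = \<psi> (\<kappa> q) w'" using eq by (simp add: \<theta>_def)
      then have "\<kappa> p = \<kappa> q \<and> w = w'" using copy_family_inj[OF J] \<kappa> pq 2 by blast
      then have "f p = f q" "w = w'" using \<kappa> pq by metis+
      then show ?thesis using X(3) pq by (auto dest: inj_onD)
    next
      case 3
      then show ?thesis using eq \<phi>\<psi>[OF pq, of w w'] by (simp add: \<theta>_def)
    next
      case 4
      then show ?thesis using eq \<phi>\<psi>[OF pq(2,1), of w' w] by (simp add: \<theta>_def)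
    qed
  qed
  moreover have "\<theta> p ` (C \<union> C') \<subseteq> {..<n} \<and>
      (\<forall>(e, c')\<in>insert ({u, v}, c) (K \<union> K'). (\<theta> p ` e, c') \<in> set h')" if p: "p \<in> ?I" for p
  proof
    have ij: "\<iota> p \<in> I" "\<kappa> p \<in> J" using \<iota> \<kappa> p by auto
    then have "\<phi> (\<iota> p) ` C \<subseteq> {..<n}" "\<psi> (\<kappa> p) ` C' \<subseteq> {..<n}"
      using I J unfolding copy_family_def by blast+
    then show "\<theta> p ` (C \<union> C') \<subseteq> {..<n}"
      using \<theta>C[of C p] \<theta>C'[of C' p] by (simp add: image_Un)
    show "\<forall>(e, c')\<in>insert ({u, v}, c) (K \<union> K'). (\<theta> p ` e, c') \<in> set h'"
    proof (clarify)
      fix e c' assume "(e, c') \<in> insert ({u, v}, c) (K \<union> K')"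
      then consider "e = {u, v}" "c' = c" | "(e, c') \<in> K" | "(e, c') \<in> K'" by blast
      then show "(\<theta> p ` e, c') \<in> set h'"
      proof cases
        case 1
        have "\<theta> p u = p" "\<theta> p v = f p" using assms(4-6) \<iota>[of p] \<kappa>[of p] p by (auto simp: \<theta>_def)
        then show ?thesis using 1 col[of p] p by auto
      next
        case 2
        then have "(\<phi> (\<iota> p) ` e, c') \<in> set h" using I ij unfolding copy_family_def by blast
        then show ?thesis using \<theta>C[OF K(1)[OF 2]] h'(1) by auto
      next
        case 3
        then have "(\<psi> (\<kappa> p) ` e, c') \<in> set h" using J ij unfolding copy_family_def by blast
        then show ?thesis using \<theta>C'[OF K(2)[OF 3]] h'(1) by auto
      qed
    qed
  qed
  ultimately have "copy_family n h' (insert ({u, v}, c) (K \<union> K')) (C \<union> C') ?I \<theta>"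
    unfolding copy_family_def using finX by blast
  then show ?thesis using c by blast
qed

text \<open>The order of magnitude of the number of copies of a fixed tree with \<open>e\<close> edges in a random graph
  with \<open>n\<close> vertices and \<open>m\<close> edges.\<close>

definition tree_count :: "nat \<Rightarrow> nat \<Rightarrow> nat \<Rightarrow> real" where
  "tree_count n m e = real n * (real m / real n) ^ e"

lemma tree_count_antimono:
  assumes "m \<le> n" "e \<le> e'" shows "tree_count n m e' \<le> tree_count n m e"
proof -
  have "real m / real n \<le> 1" using assms(1) by (cases "n = 0") simp_all
  then have "(real m / real n) ^ e' \<le> (real m / real n) ^ e"
    using assms(2) by (intro power_decreasing) auto
  then show ?thesis unfolding tree_count_def by (intro mult_left_mono) auto
qed

text \<open>The heuristic behind it: the first two factors count pairs of copies, and a round of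
  \<open>m\<close> edges draws the edge between two given vertices with probability of order m /
  n^2. The \<open>Suc\<close> is this joining edge.\<close>

lemma tree_count_merge:
  "n > 0 \<Longrightarrow> tree_count n m e * tree_count n m e' * real m / (real n * real n) = tree_count n m (Suc (e + e'))"
  by (simp add: tree_count_def power_add field_simps)

section \<open>Abundant copies of the components of a deterministic position\<close>

definition coloured_component :: "history \<Rightarrow> nat \<Rightarrow> (nat set \<times> nat) set" where
  "coloured_component g v = {x \<in> set g. fst x \<subseteq> component (board_edges g) v}"

text \<open>Disjointness is demanded within one family only. Families for different board vertices
  may overlap; they are separated when two of them are merged or when one copy of each component is
  chosen.\<close>

definition abundant_at :: "nat \<Rightarrow> nat \<Rightarrow> real \<Rightarrow> history \<Rightarrow> history \<Rightarrow> nat \<Rightarrow> bool" where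
  "abundant_at n m \<delta> g h v \<longleftrightarrow>
     (\<exists>I \<phi>. copy_family n h (coloured_component g v) (component (board_edges g) v) I \<phi> \<and>
        \<delta> * tree_count n m (card (component_edges (board_edges g) v)) \<le> real (card I))"

definition abundant :: "nat \<Rightarrow> nat \<Rightarrow> nat \<Rightarrow> real \<Rightarrow> history \<Rightarrow> history \<Rightarrow> bool" where
  "abundant n m a \<delta> g h \<longleftrightarrow> (\<forall>v<a. abundant_at n m \<delta> g h v)"

lemma abundant_at_mono:
  assumes "abundant_at n m \<delta> g h v" "set h \<subseteq> set h'" "\<delta>' \<le> \<delta>"
  shows "abundant_at n m \<delta>' g h' v"
proof -
  have "\<delta>' * tree_count n m e \<le> \<delta> * tree_count n m e" for e
    using assms(3) by (intro mult_right_mono) (auto simp: tree_count_def)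
  then show ?thesis using assms(1,2) copy_family_extend unfolding abundant_at_def
    by (meson order.trans)
qed

lemma abundant_Nil: "abundant n m a 1 [] []"
  unfolding abundant_def abundant_at_def
proof (intro allI impI exI conjI)
  fix v
  have comp: "component {} v = {v}" for v :: nat
    using component_closed_subset[of v "{v}" "{}"] by auto
  show "copy_family n [] (coloured_component [] v) (component (board_edges []) v) {..<n} (\<lambda>i w. i)"
    by (auto simp: copy_family_def coloured_component_def comp inj_on_def)
  show "1 * tree_count n m (card (component_edges (board_edges []) v)) \<le> real (card {..<n})"
    by (simp add: tree_count_def component_edges_def)
qed

text \<open>Greedy embedding, component by component: the at most \<open>a\<close> vertices used so
  far spoil at most \<open>a\<close> copies of the next component, and more than \<open>a\<close>
  are available.\<close>

lemma abundant_embeds: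
  assumes edges: "board_edges g \<subseteq> all_edges {..<a}" and ab: "abundant n m a \<delta> g h"
    and large: "\<And>v. v < a \<Longrightarrow> real a < \<delta> * tree_count n m (card (component_edges (board_edges g) v))"
  shows "\<exists>\<Phi>. inj_on \<Phi> {..<a} \<and> \<Phi> ` {..<a} \<subseteq> {..<n} \<and> (\<forall>(e, c)\<in>set g. (\<Phi> ` e, c) \<in> set h)"
proof -
  let ?B = "board_edges g" and ?C = "component (board_edges g)"
  have Ca: "?C v \<subseteq> {..<a}" if "v < a" for v
    by (rule component_closed_subset) (use that edges in auto)
  have "\<exists>\<Phi>. inj_on \<Phi> (\<Union>v<b. ?C v) \<and> \<Phi> ` (\<Union>v<b. ?C v) \<subseteq> {..<n} \<and>
      (\<forall>(e, c)\<in>set g. e \<subseteq> (\<Union>v<b. ?C v) \<longrightarrow> (\<Phi> ` e, c) \<in> set h)" if "b \<le> a" for b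
    using that
  proof (induction b)
    case 0
    have "\<not> e \<subseteq> {}" if "(e, c) \<in> set g" for e c
      using that edges by (force simp: board_edges_def all_edges_def)
    then show ?case by auto
  next
    case (Suc b)
    let ?U = "\<Union>v<b. ?C v"
    from Suc obtain \<Phi> where \<Phi>: "inj_on \<Phi> ?U" "\<Phi> ` ?U \<subseteq> {..<n}"
      "\<And>e c. (e, c) \<in> set g \<Longrightarrow> e \<subseteq> ?U \<Longrightarrow> (\<Phi> ` e, c) \<in> set h" by fastforce
    have U: "(\<Union>v<Suc b. ?C v) = ?U \<union> ?C b" by (auto simp: less_Suc_eq)
    show ?case
    proof (cases "?C b \<inter> ?U = {}")
      case False
      then obtain v w where "v < b" "w \<in> ?C b" "w \<in> ?C v" by blast
      then have "?C b = ?C v" using component_eq by metis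
      then have "?U \<union> ?C b = ?U" using \<open>v < b\<close> by blast
      then show ?thesis using \<Phi> unfolding U by (intro exI[of _ \<Phi>]) auto
    next
      case True
      have "?U \<subseteq> {..<a}" using Ca Suc.prems by (meson UN_least less_le_trans lessThan_iff Suc_leD)
      then have finU: "finite ?U" "card ?U \<le> a"
        using finite_subset[of ?U "{..<a}"] card_mono[of "{..<a}" ?U] by (blast, simp)
      have "b < a" using Suc.prems by simp
      then obtain I \<phi> where I: "copy_family n h (coloured_component g b) (?C b) I \<phi>"
        "\<delta> * tree_count n m (card (component_edges ?B b)) \<le> real (card I)"
        using ab by (auto simp: abundant_def abundant_at_def)
      have "card {i \<in> I. \<phi> i ` ?C b \<inter> \<Phi> ` ?U \<noteq> {}} \<le> card (\<Phi> ` ?U)"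
        by (rule card_hit_copies[OF I(1)]) (use finU in auto)
      also have "\<dots> \<le> a" using card_image_le[OF finU(1), of \<Phi>] finU(2) by linarith
      also have "a < card I" using I(2) large[OF \<open>b < a\<close>] by linarith
      finally have "{i \<in> I. \<phi> i ` ?C b \<inter> \<Phi> ` ?U \<noteq> {}} \<noteq> I" by auto
      then obtain i where i: "i \<in> I" "\<phi> i ` ?C b \<inter> \<Phi> ` ?U = {}" by auto
      have i': "\<phi> i ` ?C b \<subseteq> {..<n}" "\<And>e c. (e, c) \<in> coloured_component g b \<Longrightarrow> (\<phi> i ` e, c) \<in> set h"
        using I(1) i(1) unfolding copy_family_def by blast+
      define \<Psi> where "\<Psi> w = (if w \<in> ?C b then \<phi> i w else \<Phi> w)" for w
      have \<Psi>C: "\<Psi> ` e = \<phi> i ` e" if "e \<subseteq> ?C b" for e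
        using that by (intro image_cong) (auto simp: \<Psi>_def)
      have \<Psi>U: "\<Psi> ` e = \<Phi> ` e" if "e \<subseteq> ?U" for e
        using that True by (intro image_cong) (auto simp: \<Psi>_def)
      have "inj_on (\<phi> i) (?C b)" using copy_family_inj[OF I(1) i(1) i(1)] by (auto intro: inj_onI)
      then have "inj_on \<Psi> (?C b)" by (rule inj_on_cong[THEN iffD1, rotated]) (simp add: \<Psi>_def)
      moreover have "inj_on \<Psi> ?U"
        using \<Phi>(1) by (rule inj_on_cong[THEN iffD1, rotated]) (use True in \<open>auto simp: \<Psi>_def\<close>)
      ultimately have "inj_on \<Psi> (?U \<union> ?C b)"
        using \<Psi>C[OF subset_refl] \<Psi>U[OF subset_refl] i(2)
        by (auto simp: inj_on_Un) (blast dest: equalityD1)+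
      moreover have "\<Psi> ` (?U \<union> ?C b) \<subseteq> {..<n}"
        using \<Psi>C[OF subset_refl] \<Psi>U[OF subset_refl] i'(1) \<Phi>(2) by (simp add: image_Un)
      moreover have "(\<Psi> ` e, c) \<in> set h" if e: "(e, c) \<in> set g" "e \<subseteq> ?U \<union> ?C b" for e c
      proof -
        have eB: "e \<in> ?B" using e(1) by (force simp: board_edges_def)
        then have c2: "card e = 2" using edges by (auto simp: all_edges_def)
        then obtain x where x: "x \<in> e" by fastforce
        have ex: "e \<subseteq> ?C x" by (rule edge_subset_component[OF eB c2 x])
        consider "x \<in> ?C b" | v where "v < b" "x \<in> ?C v" using e(2) x by blast
        then show ?thesis
        proof cases
          case 1
          then have "e \<subseteq> ?C b" using ex component_eq by metis
          then show ?thesis using \<Psi>C i'(2) e(1) by (simp add: coloured_component_def)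
        next
          case 2
          then have "e \<subseteq> ?C v" using ex component_eq by metis
          then have "e \<subseteq> ?U" using 2(1) by blast
          then show ?thesis using \<Psi>U \<Phi>(3) e(1) by simp
        qed
      qed
      ultimately show ?thesis unfolding U by (intro exI[of _ \<Psi>]) auto
    qed
  qed
  from this[of a] obtain \<Phi> where \<Phi>: "inj_on \<Phi> (\<Union>v<a. ?C v)" "\<Phi> ` (\<Union>v<a. ?C v) \<subseteq> {..<n}"
    "\<And>e c. (e, c) \<in> set g \<Longrightarrow> e \<subseteq> (\<Union>v<a. ?C v) \<Longrightarrow> (\<Phi> ` e, c) \<in> set h" by fastforce
  have Ua: "(\<Union>v<a. ?C v) = {..<a}" using Ca by (auto intro: component_refl)
  have "e \<subseteq> {..<a}" if "(e, c) \<in> set g" for e c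
    using that edges by (force simp: board_edges_def all_edges_def)
  then show ?thesis using \<Phi> unfolding Ua by (intro exI[of _ \<Phi>]) auto
qed

lemma mono_copy_transfer:
  assumes "mono_copy V E a g" "inj_on \<Phi> {..<a}" "\<Phi> ` {..<a} \<subseteq> {..<n}"
    "\<forall>(e, c)\<in>set g. (\<Phi> ` e, c) \<in> set h"
  shows "mono_copy V E n h"
proof -
  obtain c f where f: "inj_on f V" "f ` V \<subseteq> {..<a}" "\<And>e. e \<in> E \<Longrightarrow> (f ` e, c) \<in> set g"
    using assms(1) unfolding mono_copy_def contains_copy_def by blast
  have "inj_on (\<Phi> \<circ> f) V" using f(1,2) assms(2) by (intro comp_inj_on) (auto intro: inj_on_subset)
  moreover have "(\<Phi> \<circ> f) ` V \<subseteq> {..<n}" using f(2) assms(3) by (auto simp: image_subset_iff)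
  moreover have "((\<Phi> \<circ> f) ` e, c) \<in> set h" if "e \<in> E" for e
    unfolding image_comp[symmetric] using assms(4) f(3)[OF that] by blast
  ultimately show ?thesis unfolding mono_copy_def contains_copy_def by blast
qed

section \<open>One round of the random game\<close>

lemma card_component_edges_insert:
  assumes B: "B \<subseteq> all_edges A" "finite B" and uv: "{u, v} \<notin> B" "v \<notin> component B u"
    and w: "w \<in> component B u \<union> component B v"
  shows "card (component_edges (insert {u, v} B) w) =
    Suc (card (component_edges B u) + card (component_edges B v))"
proof -
  let ?C = "component B"
  have disj: "?C u \<inter> ?C v = {}" by (rule components_disjoint[OF uv(2)])
  have split: "e \<subseteq> ?C u \<or> e \<subseteq> ?C v" if "e \<in> B" "e \<subseteq> ?C u \<union> ?C v" for e
    using edge_subset_component_union[OF that(1) _ that(2)] that(1) B(1) by (auto simp: all_edges_def)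
  have "component_edges (insert {u, v} B) w = insert {u, v} (component_edges B u \<union> component_edges B v)"
    unfolding component_edges_def component_insert_union[OF w] using split by auto
  moreover have "component_edges B u \<inter> component_edges B v = {}"
  proof (rule ccontr)
    assume "component_edges B u \<inter> component_edges B v \<noteq> {}"
    then obtain e where e: "e \<in> B" "e \<subseteq> ?C u" "e \<subseteq> ?C v" by (auto simp: component_edges_def)
    then have "e = {}" using disj by blast
    then show False using e(1) B(1) by (auto simp: all_edges_def)
  qed
  moreover have "finite (component_edges B u)" "finite (component_edges B v)"
    using B(2) by (auto simp: component_edges_def)
  moreover have "{u, v} \<notin> component_edges B u \<union> component_edges B v"
    using uv(1) by (auto simp: component_edges_def)
  ultimately show ?thesis by (simp add: card_Un_disjoint)
qed

text \<open>Components that avoid the new edge keep their families with the weaker constant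
  \<open>\<delta>'\<close>; the merged component is served by \<open>fam\<close>.\<close>

lemma abundant_snoc:
  assumes legal: "legal_play a k g" and uv: "{u, v} \<notin> board_edges g" "v \<notin> component (board_edges g) u"
    and ab: "abundant n m a \<delta> g h" and h': "set h \<subseteq> set h'" and \<delta>': "\<delta>' \<le> \<delta>"
    and fam: "copy_family n h' (insert ({u, v}, c) (coloured_component g u \<union> coloured_component g v))
      (component (board_edges g) u \<union> component (board_edges g) v) I \<theta>"
    and card: "\<delta>' * tree_count n m (Suc (card (component_edges (board_edges g) u) +
      card (component_edges (board_edges g) v))) \<le> real (card I)"
  shows "abundant n m a \<delta>' (g @ [({u, v}, c)]) h'"
  unfolding abundant_def
proof (intro allI impI)
  fix w assume "w < a"
  let ?B = "board_edges g" and ?g = "g @ [({u, v}, c)]"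
  have B: "?B \<subseteq> all_edges {..<a}" using legal_play_edges[OF legal] by blast
  show "abundant_at n m \<delta>' ?g h' w"
  proof (cases "w \<in> component ?B u \<union> component ?B v")
    case True
    have comp: "component (insert {u, v} ?B) w = component ?B u \<union> component ?B v"
      by (rule component_insert_union[OF True])
    have split: "e \<subseteq> component ?B u \<or> e \<subseteq> component ?B v"
      if e: "(e, c') \<in> set g" "e \<subseteq> component ?B u \<union> component ?B v" for e c'
    proof -
      have eB: "e \<in> ?B" using e(1) by (force simp: board_edges_def)
      then have c2: "card e = 2" using B by (auto simp: all_edges_def)
      from edge_subset_component_union[OF eB this e(2)] show ?thesis .
    qed
    have "coloured_component ?g w \<subseteq>
        insert ({u, v}, c) (coloured_component g u \<union> coloured_component g v)"
    proof
      fix x assume x: "x \<in> coloured_component ?g w"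
      obtain e c' where ec: "x = (e, c')" by fastforce
      show "x \<in> insert ({u, v}, c) (coloured_component g u \<union> coloured_component g v)"
        using x split[of e c'] unfolding ec coloured_component_def board_edges_snoc comp by auto
    qed
    then have "copy_family n h' (coloured_component ?g w) (component (board_edges ?g) w) I \<theta>"
      using fam copy_family_antimono unfolding board_edges_snoc comp by blast
    moreover have "card (component_edges (board_edges ?g) w) =
        Suc (card (component_edges ?B u) + card (component_edges ?B v))"
      using card_component_edges_insert[OF B finite_board_edges uv True] by simp
    ultimately show ?thesis using card unfolding abundant_at_def by auto
  next
    case False
    have comp: "component (insert {u, v} ?B) w = component ?B w"
      using False by (intro component_insert_other) auto
    have "u \<notin> component ?B w" using False component_sym[of u ?B w] by blast
    then have "coloured_component ?g w = coloured_component g w"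
      "component_edges (insert {u, v} ?B) w = component_edges ?B w"
      by (auto simp: coloured_component_def component_edges_def comp)
    moreover have "abundant_at n m \<delta>' g h' w"
      using ab abundant_at_mono[OF _ h' \<delta>'] \<open>w < a\<close> unfolding abundant_def by blast
    ultimately show ?thesis unfolding abundant_at_def by (simp add: comp)
  qed
qed

lemma nat_floor_half: "1 \<le> (x::real) \<Longrightarrow> x / 2 \<le> real (nat \<lfloor>x\<rfloor>)"
proof -
  assume "1 \<le> x"
  then have "real (nat \<lfloor>x\<rfloor>) = of_int \<lfloor>x\<rfloor>" "1 \<le> \<lfloor>x\<rfloor>" by auto
  moreover have "x < of_int \<lfloor>x\<rfloor> + 1" by linarith
  moreover have "(1::real) \<le> of_int \<lfloor>x\<rfloor>" using \<open>1 \<le> \<lfloor>x\<rfloor>\<close> by simp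
  ultimately show ?thesis by linarith
qed

text \<open>The component of \<open>u\<close> has at least as many edges, hence the smaller
  guaranteed number of copies. Only a small share of these is kept, so that they spoil at most half
  of the copies guaranteed for \<open>v\<close>; then a matching between the images of
  \<open>u\<close> and \<open>v\<close> is sought. The constants do not depend on \<open>n\<close>,
  \<open>m\<close>, the strategy or the history.\<close>

lemma round_preserves_abundance_aux:
  assumes legal: "legal_play a k g" and move: "legal_move a k (board_edges g) {u, v}"
    and le: "card (component_edges (board_edges g) v) \<le> card (component_edges (board_edges g) u)"
    and \<delta>: "\<delta> > 0" and r: "r > 0"
  shows "\<exists>\<delta>'>0. \<exists>\<gamma>>0. \<exists>L. \<forall>n m \<sigma> h. 0 < m \<longrightarrow> m \<le> n \<longrightarrow> L \<le> tree_count n m k \<longrightarrow>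
    painter_strategy r \<sigma> \<longrightarrow> snd ` set h \<subseteq> {..<r} \<longrightarrow> abundant n m a \<delta> g h \<longrightarrow>
    measure (measure_pmf (game_from n \<sigma> h m))
      {h'. \<not> (\<exists>c<r. abundant n m a \<delta>' (g @ [({u, v}, c)]) h')} \<le> exp (- \<gamma> * tree_count n m k)"
proof -
  let ?B = "board_edges g"
  let ?Cu = "component ?B u" and ?Cv = "component ?B v"
  define eu ev where "eu = card (component_edges ?B u)" and "ev = card (component_edges ?B v)"
  have uva: "u < a" "v < a" "u \<noteq> v" and nB: "{u, v} \<notin> ?B" and acyc: "acyclic_graph (insert {u, v} ?B)"
    using move by (auto simp: legal_move_def)
  have B: "?B \<subseteq> all_edges {..<a}" using legal_play_edges[OF legal] by blast
  have dis: "v \<notin> ?Cu" by (rule acyclic_insert_imp_disconnected[OF acyc nB uva(3)])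
  have disj: "?Cu \<inter> ?Cv = {}" by (rule components_disjoint[OF dis])
  have eK: "Suc (eu + ev) \<le> k"
    using card_component_edges_insert[OF B finite_board_edges nB dis, of u] move uva(1)
    by (auto simp: legal_move_def eu_def ev_def)
  have Ca: "?Cu \<subseteq> {..<a}" by (rule component_closed_subset) (use uva B in auto)
  then have finCu: "finite ?Cu" and cCu: "card ?Cu \<le> a"
    using finite_subset card_mono[of "{..<a}" ?Cu] by auto
  define A where "A = real a"
  have A: "1 \<le> A" using uva by (simp add: A_def)
  \<comment> \<open>At least \<open>\<delta> * Mu / (4 * A)\<close> copies for \<open>u\<close> and
    \<open>\<delta> * Mv / 2\<close> for \<open>v\<close> will be in use; dividing the product by 4
    n^2 gives the constant \<open>\<delta>\<^sup>2 / (32 * A)\<close>.\<close>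
  define \<beta> where "\<beta> = \<delta>\<^sup>2 / (32 * A)"
  \<comment> \<open>The first bound keeps the matching size \<open>s\<close> below a quarter of
    \<open>z = \<beta> * Me\<close>, the second keeps \<open>2 * s\<close> within both
    families.\<close>
  define \<epsilon> where "\<epsilon> = min (\<beta> / 4) (\<delta> / (8 * A))"
  \<comment> \<open>Rounding down costs the factor 2, the choice of a colour the factor
    \<open>r\<close>.\<close>
  define \<delta>' where "\<delta>' = min \<delta> (\<epsilon> / (2 * real r))"
  \<comment> \<open>Large enough for \<open>T\<close> and \<open>\<epsilon> * Me\<close> to be at
    least 1 before they are rounded down.\<close>
  define L where "L = max (2 * A / \<delta>) (1 / \<epsilon>)"
  have pos: "0 < \<beta>" "0 < \<epsilon>" "0 < \<delta>'" using \<delta> A r by (auto simp: \<beta>_def \<epsilon>_def \<delta>'_def)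
  have main: "measure (measure_pmf (game_from n \<sigma> h m))
      {h'. \<not> (\<exists>c<r. abundant n m a \<delta>' (g @ [({u, v}, c)]) h')} \<le> exp (- (\<beta> / 4) * tree_count n m k)"
    if m: "0 < m" "m \<le> n" and Lk: "L \<le> tree_count n m k" and \<sigma>: "painter_strategy r \<sigma>"
      and col: "snd ` set h \<subseteq> {..<r}" and ab: "abundant n m a \<delta> g h" for n m \<sigma> h
  proof -
    define Mu Mv Me where "Mu = tree_count n m eu" and "Mv = tree_count n m ev"
      and "Me = tree_count n m (Suc (eu + ev))"
    have mono: "Mu \<le> Mv" "Me \<le> Mu" "tree_count n m k \<le> Me"
      unfolding Mu_def Mv_def Me_def using le eK
      by (auto intro!: tree_count_antimono m simp: eu_def ev_def)
    have LMe: "2 * A / \<delta> \<le> Me" "1 / \<epsilon> \<le> Me" using Lk mono by (auto simp: L_def)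
    have Mpos: "0 < Me" using LMe pos(2) by (meson divide_pos_pos less_le_trans zero_less_one)
    obtain I0 \<phi> where I0: "copy_family n h (coloured_component g u) ?Cu I0 \<phi>" "\<delta> * Mu \<le> real (card I0)"
      using ab uva(1) by (auto simp: abundant_def abundant_at_def Mu_def eu_def)
    obtain J0 \<psi> where J0: "copy_family n h (coloured_component g v) ?Cv J0 \<psi>" "\<delta> * Mv \<le> real (card J0)"
      using ab uva(2) by (auto simp: abundant_def abundant_at_def Mv_def ev_def)
    \<comment> \<open>At most \<open>T\<close> copies with at most \<open>A\<close> vertices each
      cover at most \<open>\<delta> * Mu / 2\<close> vertices, and
      \<open>Mu \<le> Mv\<close>.\<close>
    define T where "T = \<delta> * Mu / (2 * A)"
    define x where "x = nat \<lfloor>T\<rfloor>"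
    have "2 * A / \<delta> \<le> Mu" using LMe(1) mono by linarith
    then have T1: "1 \<le> T" using \<delta> A by (simp add: T_def field_simps)
    have xT: "T / 2 \<le> real x" "real x \<le> T" using nat_floor_half[OF T1] T1 by (auto simp: x_def)
    have MuA: "T \<le> \<delta> * Mu"
    proof -
      have "\<delta> * Mu * 1 \<le> \<delta> * Mu * (2 * A)" using A \<delta> mono Mpos by (intro mult_left_mono) auto
      then show ?thesis using A by (simp add: T_def field_simps)
    qed
    have "real x \<le> real (card I0)" using xT(2) MuA I0(2) by linarith
    then obtain I where I: "I \<subseteq> I0" "card I = x"
      using obtain_subset_with_card_n[of x I0] by auto
    have famI: "copy_family n h (coloured_component g u) ?Cu I \<phi>"
      by (rule copy_family_subset[OF I0(1) I(1)])
    obtain J where J: "J \<subseteq> J0" "card J0 \<le> card J + card I * card ?Cu"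
      "\<And>i j. i \<in> I \<Longrightarrow> j \<in> J \<Longrightarrow> \<phi> i ` ?Cu \<inter> \<psi> j ` ?Cv = {}"
      using separate_families[OF famI J0(1) finCu] by blast
    have famJ: "copy_family n h (coloured_component g v) ?Cv J \<psi>"
      by (rule copy_family_subset[OF J0(1) J(1)])
    have "real (card I * card ?Cu) \<le> T * A"
      unfolding of_nat_mult using xT(2) cCu T1 I(2) by (intro mult_mono) (auto simp: A_def)
    also have "T * A = \<delta> * Mu / 2" using A by (simp add: T_def)
    finally have "real (card I * card ?Cu) \<le> \<delta> * Mu / 2" .
    moreover have "\<delta> * Mu \<le> \<delta> * Mv" using mono \<delta> by simp
    moreover have "real (card J0) \<le> real (card J) + real (card I * card ?Cu)"
      using J(2) by (simp flip: of_nat_add of_nat_mult)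
    ultimately have y: "\<delta> * Mv / 2 \<le> real (card J)" using J0(2) by linarith
    define s where "s = nat \<lfloor>\<epsilon> * Me\<rfloor>"
    have s1: "1 \<le> \<epsilon> * Me" using LMe(2) pos(2) by (simp add: field_simps)
    have s: "\<epsilon> * Me / 2 \<le> real s" "real s \<le> \<epsilon> * Me"
      using nat_floor_half[OF s1] s1 by (auto simp: s_def)
    have "\<epsilon> * Me \<le> \<delta> / (8 * A) * Me" using Mpos by (intro mult_right_mono) (auto simp: \<epsilon>_def)
    also have "\<dots> \<le> \<delta> / (8 * A) * Mu" using mono \<delta> A by (intro mult_left_mono) auto
    also have "\<dots> = T / 4" by (simp add: T_def)
    finally have sT: "real s \<le> T / 4" using s by linarith
    then have sI: "2 * s \<le> card I" using xT(1) I(2) by linarith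
    have sJ: "2 * s \<le> card J"
      using sT MuA y \<open>\<delta> * Mu \<le> \<delta> * Mv\<close> T1 by linarith
    let ?P = "(\<lambda>i. \<phi> i u) ` I" and ?Q = "(\<lambda>j. \<psi> j v) ` J"
    have "inj_on (\<lambda>i. \<phi> i u) I" "inj_on (\<lambda>j. \<psi> j v) J"
      using copy_family_inj[OF famI] copy_family_inj[OF famJ] component_refl by (meson inj_onI)+
    then have cP: "card ?P = card I" "card ?Q = card J" by (auto simp: card_image)
    have PQn: "?P \<subseteq> {..<n}" "?Q \<subseteq> {..<n}"
      using copy_family_range[OF famI] copy_family_range[OF famJ] by auto
    have PQ: "?P \<inter> ?Q = {}"
    proof (rule ccontr)
      assume "?P \<inter> ?Q \<noteq> {}"
      then obtain i j where "i \<in> I" "j \<in> J" "\<phi> i u = \<psi> j v" by auto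
      moreover have "\<phi> i u \<in> \<phi> i ` ?Cu" "\<psi> j v \<in> \<psi> j ` ?Cv" by auto
      ultimately show False using J(3)[of i j] by (metis IntI empty_iff)
    qed
    have n: "0 < n" using m by simp
    have "T / 2 * (\<delta> * Mv / 2) \<le> real (card I) * real (card J)"
      using xT(1) y T1 I(2) by (intro mult_mono) (use \<delta> mono Mpos in auto)
    then have "T / 2 * (\<delta> * Mv / 2) / (4 * real n * real n) * real m \<le>
        real (card I) * real (card J) / (4 * real n * real n) * real m"
      by (intro mult_right_mono divide_right_mono) auto
    moreover have "T / 2 * (\<delta> * Mv / 2) / (4 * real n * real n) * real m =
        \<beta> * (Mu * Mv * real m / (real n * real n))"
      using A n by (simp add: T_def \<beta>_def field_simps power2_eq_square)
    moreover have "Mu * Mv * real m / (real n * real n) = Me"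
      unfolding Mu_def Mv_def Me_def by (rule tree_count_merge[OF n])
    ultimately have z: "\<beta> * Me \<le> real (card ?P) * real (card ?Q) / (4 * real n * real n) * real m"
      by (simp add: cP)
    have "\<epsilon> * Me \<le> \<beta> / 4 * Me" using Mpos by (intro mult_right_mono) (auto simp: \<epsilon>_def)
    then have z': "real s \<le> \<beta> * Me / 4" using s(2) by simp
    have good: "\<exists>c<r. abundant n m a \<delta>' (g @ [({u, v}, c)]) h'"
      if h': "h' \<in> set_pmf (game_from n \<sigma> h m)" and match: "has_matching ?P ?Q (board_edges h') s" for h'
    proof -
      have ext: "set h \<subseteq> set h'" by (rule game_from_extends[OF h'])
      have cc: "e \<subseteq> component ?B w" if "(e, c) \<in> coloured_component g w" for e c w
        using that by (auto simp: coloured_component_def)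
      have "\<exists>c<r. \<exists>I' \<theta>. copy_family n h' (insert ({u, v}, c)
          (coloured_component g u \<union> coloured_component g v)) (?Cu \<union> ?Cv) I' \<theta> \<and> s \<le> card I' * r"
        by (rule merge_families[OF famI famJ _ component_refl component_refl disj _ _ match ext
              game_from_colours[OF h' \<sigma> col] r]) (fact J(3) cc)+
      then obtain c I' \<theta> where c: "c < r" "copy_family n h' (insert ({u, v}, c)
          (coloured_component g u \<union> coloured_component g v)) (?Cu \<union> ?Cv) I' \<theta>" "s \<le> card I' * r"
        by blast
      have "real s \<le> real (card I') * real r" using c(3) by (simp flip: of_nat_mult)
      then have "\<epsilon> * Me / 2 \<le> real (card I') * real r" using s(1) by linarith
      then have "\<epsilon> / (2 * real r) * Me \<le> real (card I')" using r by (simp add: field_simps)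
      moreover have "\<delta>' * Me \<le> \<epsilon> / (2 * real r) * Me"
        using Mpos by (intro mult_right_mono) (auto simp: \<delta>'_def)
      ultimately have "\<delta>' * Me \<le> real (card I')" by linarith
      then have "abundant n m a \<delta>' (g @ [({u, v}, c)]) h'"
        unfolding Me_def eu_def ev_def
        by (intro abundant_snoc[OF legal nB dis ab ext _ c(2)]) (auto simp: \<delta>'_def)
      then show ?thesis using c(1) by blast
    qed
    have "measure (measure_pmf (game_from n \<sigma> h m))
        {h'. \<not> (\<exists>c<r. abundant n m a \<delta>' (g @ [({u, v}, c)]) h')} \<le>
      measure (measure_pmf (game_from n \<sigma> h m)) {h'. \<not> has_matching ?P ?Q (board_edges h') s}"
      using good by (intro measure_pmf.finite_measure_mono_AE) (auto simp: AE_measure_pmf_iff)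
    also have "\<dots> \<le> exp (- (\<beta> * Me / 4))"
      by (rule no_matching_prob_exp[OF PQn PQ _ _ z z']) (use sI sJ cP in auto)
    also have "\<dots> \<le> exp (- (\<beta> / 4) * tree_count n m k)"
      using mult_left_mono[OF mono(3), of \<beta>] pos(1) by simp
    finally show ?thesis .
  qed
  show ?thesis
    by (rule exI[of _ \<delta>'], rule conjI[OF pos(3)], rule exI[of _ "\<beta> / 4"], rule conjI)
      (use pos(1) main in \<open>auto intro!: exI[of _ L]\<close>)
qed

text \<open>An edge is an unordered pair, so its ends can be named such that the second one lies in
  the component with no more edges.\<close>

lemma round_preserves_abundance:
  assumes legal: "legal_play a k g" and move: "legal_move a k (board_edges g) e"
    and \<delta>: "\<delta> > 0" and r: "r > 0"
  shows "\<exists>\<delta>'>0. \<exists>\<gamma>>0. \<exists>L. \<forall>n m \<sigma> h. 0 < m \<longrightarrow> m \<le> n \<longrightarrow> L \<le> tree_count n m k \<longrightarrow>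
    painter_strategy r \<sigma> \<longrightarrow> snd ` set h \<subseteq> {..<r} \<longrightarrow> abundant n m a \<delta> g h \<longrightarrow>
    measure (measure_pmf (game_from n \<sigma> h m))
      {h'. \<not> (\<exists>c<r. abundant n m a \<delta>' (g @ [(e, c)]) h')} \<le> exp (- \<gamma> * tree_count n m k)"
proof -
  obtain u v where e: "e = {u, v}" using move by (auto simp: legal_move_def elim: all_edges_obtain)
  have e': "e = {v, u}" using e by (simp add: insert_commute)
  show ?thesis
  proof (cases "card (component_edges (board_edges g) v) \<le> card (component_edges (board_edges g) u)")
    case True
    show ?thesis unfolding e by (rule round_preserves_abundance_aux[OF legal move[unfolded e] True \<delta> r])
  next
    case False
    then show ?thesis unfolding e' by (intro round_preserves_abundance_aux[OF legal move[unfolded e'] _ \<delta> r]) simp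
  qed
qed

text \<open>Each level of the forced win uses one round of \<open>m\<close> edges and passes from
  \<open>\<delta>\<close> to a new constant. Half of \<open>\<eta>\<close> pays for the round, half
  for the remaining levels. A single \<open>L\<close> suffices because the game tree has bounded
  depth and branches over \<open>r\<close> colours only. Steps beyond \<open>d * m\<close> do no
  harm since copies persist.\<close>

lemma force_succeeds:
  assumes "force V E r a k d g" "legal_play a k g" "r > 0" "\<delta> > 0" "\<eta> > 0"
    and small: "\<And>v. v < a \<Longrightarrow> card (component_edges (board_edges g) v) \<le> k"
  shows "\<exists>L. \<forall>n m \<sigma> h t. 0 < m \<longrightarrow> m \<le> n \<longrightarrow> L \<le> tree_count n m k \<longrightarrow>
    painter_strategy r \<sigma> \<longrightarrow> snd ` set h \<subseteq> {..<r} \<longrightarrow> abundant n m a \<delta> g h \<longrightarrow> d * m \<le> t \<longrightarrow>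
    measure (measure_pmf (game_from n \<sigma> h t)) {h'. \<not> mono_copy V E n h'} \<le> \<eta>"
proof -
  \<comment> \<open>Once the deterministic position contains the copy, abundance embeds the whole
    position into the current random board, and failure has probability 0.\<close>
  have base: "measure (measure_pmf (game_from n \<sigma> h t)) {h'. \<not> mono_copy V E n h'} \<le> \<eta>"
    if "mono_copy V E a g" "legal_play a k g" "\<delta> > 0" "\<eta> > 0" "m \<le> n"
      "(real a + 1) / \<delta> \<le> tree_count n m k" "abundant n m a \<delta> g h"
      and small: "\<And>v. v < a \<Longrightarrow> card (component_edges (board_edges g) v) \<le> k"
    for g \<delta> \<eta> n m \<sigma> h t
  proof -
    have "real a < \<delta> * tree_count n m (card (component_edges (board_edges g) v))" if "v < a" for v
    proof -
      have "(real a + 1) / \<delta> \<le> tree_count n m (card (component_edges (board_edges g) v))"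
        using tree_count_antimono[OF \<open>m \<le> n\<close> small[OF that]]
          \<open>(real a + 1) / \<delta> \<le> tree_count n m k\<close> by linarith
      then show ?thesis using \<open>\<delta> > 0\<close> by (simp add: field_simps)
    qed
    from abundant_embeds[OF _ that(7) this] legal_play_edges[OF that(2)]
    have "mono_copy V E n h" using mono_copy_transfer[OF that(1)] by blast
    then have "measure (measure_pmf (game_from n \<sigma> h t)) {h'. \<not> mono_copy V E n h'} = 0"
      by (intro measure_pmf_eq_0I) (use mono_copy_mono game_from_extends in blast)
    then show ?thesis using \<open>\<eta> > 0\<close> by simp
  qed
  show ?thesis using assms
  proof (induction d arbitrary: g \<delta> \<eta>)
    case 0
    then have "mono_copy V E a g" by simp
    from base[OF this 0(2,4,5) _ _ _ 0(6)] show ?case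
      by (intro exI[of _ "(real a + 1) / \<delta>"] allI impI)
  next
    case (Suc d)
    show ?case
    proof (cases "mono_copy V E a g")
      case True
      from base[OF True Suc.prems(2,4,5) _ _ _ Suc.prems(6)] show ?thesis
        by (intro exI[of _ "(real a + 1) / \<delta>"] allI impI)
    next
      case False
      then obtain e where e: "legal_move a k (board_edges g) e"
        "\<And>c. c < r \<Longrightarrow> force V E r a k d (g @ [(e, c)])" using Suc.prems(1) by auto
      obtain \<delta>' \<gamma> L0 where R: "\<delta>' > 0" "\<gamma> > 0"
        "\<And>n m \<sigma> h. \<lbrakk>0 < m; m \<le> n; L0 \<le> tree_count n m k; painter_strategy r \<sigma>; snd ` set h \<subseteq> {..<r};
          abundant n m a \<delta> g h\<rbrakk> \<Longrightarrow> measure (measure_pmf (game_from n \<sigma> h m))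
          {h'. \<not> (\<exists>c<r. abundant n m a \<delta>' (g @ [(e, c)]) h')} \<le> exp (- \<gamma> * tree_count n m k)"
        using round_preserves_abundance[OF Suc.prems(2) e(1) Suc.prems(4,3)] by blast
      have "\<forall>c<r. \<exists>L. \<forall>n m \<sigma> h t. 0 < m \<longrightarrow> m \<le> n \<longrightarrow> L \<le> tree_count n m k \<longrightarrow>
        painter_strategy r \<sigma> \<longrightarrow> snd ` set h \<subseteq> {..<r} \<longrightarrow> abundant n m a \<delta>' (g @ [(e, c)]) h \<longrightarrow>
        d * m \<le> t \<longrightarrow>
        measure (measure_pmf (game_from n \<sigma> h t)) {h'. \<not> mono_copy V E n h'} \<le> \<eta> / 2"
      proof (intro allI impI)
        fix c assume c: "c < r"
        show "\<exists>L. \<forall>n m \<sigma> h t. 0 < m \<longrightarrow> m \<le> n \<longrightarrow> L \<le> tree_count n m k \<longrightarrow>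
          painter_strategy r \<sigma> \<longrightarrow> snd ` set h \<subseteq> {..<r} \<longrightarrow> abundant n m a \<delta>' (g @ [(e, c)]) h \<longrightarrow>
          d * m \<le> t \<longrightarrow>
          measure (measure_pmf (game_from n \<sigma> h t)) {h'. \<not> mono_copy V E n h'} \<le> \<eta> / 2"
          by (rule Suc.IH) (use Suc.prems e c R(1) in \<open>auto simp: legal_move_def\<close>)
      qed
      then obtain L1 where L1: "\<And>c n m \<sigma> h t. \<lbrakk>c < r; 0 < m; m \<le> n; L1 c \<le> tree_count n m k;
          painter_strategy r \<sigma>; snd ` set h \<subseteq> {..<r}; abundant n m a \<delta>' (g @ [(e, c)]) h; d * m \<le> t\<rbrakk> \<Longrightarrow>
          measure (measure_pmf (game_from n \<sigma> h t)) {h'. \<not> mono_copy V E n h'} \<le> \<eta> / 2"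
        by metis
      \<comment> \<open>From this size on \<open>exp (- \<gamma> * tree_count n m k)\<close> is at
        most \<open>\<eta> / 2\<close>.\<close>
      define L2 where "L2 = - ln (\<eta> / 2) / \<gamma>"
      define L where "L = Max (insert L0 (insert L2 (L1 ` {..<r})))"
      have Lge: "L0 \<le> L" "L2 \<le> L" "\<And>c. c < r \<Longrightarrow> L1 c \<le> L" 
        unfolding L_def by (auto intro!: Max_ge simp del: Max_insert)
      have "measure (measure_pmf (game_from n \<sigma> h t)) {h'. \<not> mono_copy V E n h'} \<le> \<eta>"
        if H: "0 < m" "m \<le> n" "L \<le> tree_count n m k" "painter_strategy r \<sigma>" "snd ` set h \<subseteq> {..<r}"
          "abundant n m a \<delta> g h" "Suc d * m \<le> t" for n m \<sigma> h t
      proof -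
        let ?Bad = "{h'. \<not> (\<exists>c<r. abundant n m a \<delta>' (g @ [(e, c)]) h')}"
        have t: "t = m + (t - m)" "d * m \<le> t - m" using H(7) by auto
        have "measure (measure_pmf (game_from n \<sigma> h m)) ?Bad \<le> exp (- \<gamma> * tree_count n m k)"
          using R(3) H Lge(1) by (meson order.trans)
        also have "- \<gamma> * tree_count n m k \<le> ln (\<eta> / 2)"
        proof -
          have "L2 * \<gamma> \<le> tree_count n m k * \<gamma>" using Lge(2) H(3) R(2) by (intro mult_right_mono) auto
          then show ?thesis using R(2) by (simp add: L2_def mult.commute)
        qed
        then have "exp (- \<gamma> * tree_count n m k) \<le> exp (ln (\<eta> / 2))" by (simp only: exp_le_cancel_iff)
        also have "exp (ln (\<eta> / 2)) = \<eta> / 2" using Suc.prems(5) by simp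
        finally have bad: "measure (measure_pmf (game_from n \<sigma> h m)) ?Bad \<le> \<eta> / 2" .
        have "measure (measure_pmf (game_from n \<sigma> h t)) {h'. \<not> mono_copy V E n h'} =
            measure (measure_pmf (bind_pmf (game_from n \<sigma> h m) (\<lambda>h'. game_from n \<sigma> h' (t - m))))
              {h'. \<not> mono_copy V E n h'}"
          by (subst t(1), subst game_from_add) simp
        also have "\<dots> \<le> measure (measure_pmf (game_from n \<sigma> h m)) ?Bad + \<eta> / 2"
        proof (rule measure_bind_pmf_le)
          fix h' assume h': "h' \<in> set_pmf (game_from n \<sigma> h m)" "h' \<notin> ?Bad"
          then obtain c where c: "c < r" "abundant n m a \<delta>' (g @ [(e, c)]) h'" by blast
          show "measure (measure_pmf (game_from n \<sigma> h' (t - m))) {h'. \<not> mono_copy V E n h'} \<le> \<eta> / 2"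
            by (rule L1[OF c(1) H(1,2) order.trans[OF Lge(3)[OF c(1)] H(3)] H(4)
                  game_from_colours[OF h'(1) H(4,5)] c(2) t(2)])
        qed (use Suc.prems(5) in simp)
        finally show ?thesis using bad by linarith
      qed
      then show ?thesis by blast
    qed
  qed
qed

section \<open>Upper bound on the threshold\<close>

lemma prob_tendsto_1:
  assumes "\<And>\<eta>. \<eta> > 0 \<Longrightarrow> eventually (\<lambda>n. measure (measure_pmf (p n)) {h. \<not> P n h} \<le> \<eta>) sequentially"
  shows "(\<lambda>n. measure (measure_pmf (p n)) {h. P n h}) \<longlonglongrightarrow> 1"
proof (rule tendstoI)
  fix e :: real assume "e > 0"
  have eq: "measure (measure_pmf (p n)) {h. P n h} = 1 - measure (measure_pmf (p n)) {h. \<not> P n h}" for n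
    using measure_pmf.prob_compl[of "{h. \<not> P n h}" "p n"] by (simp add: Compl_eq_Diff_UNIV[symmetric] Collect_neg_eq)
  show "eventually (\<lambda>n. dist (measure (measure_pmf (p n)) {h. P n h}) 1 < e) sequentially"
    using assms[of "e / 2"] \<open>e > 0\<close>
    by (auto elim!: eventually_mono simp: eq dist_real_def)
qed

text \<open>The origin of the exponent: \<open>n powr (1 - 1 / k)\<close> edges make the expected
  order of trees with \<open>k\<close> edges equal to 1, and a factor \<open>x\<close> in the number
  of edges changes it by \<open>x ^ k\<close>.\<close>

lemma tree_count_scale:
  assumes "k > 0" "n > 0"
  shows "real n * (x * real n powr (1 - 1 / real k) / real n) ^ k = x ^ k"
proof -
  have "real n powr (1 - 1 / real k) / real n = real n powr (- (1 / real k))"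
    using assms(2) by (simp add: powr_diff powr_minus field_simps)
  then have "(x * real n powr (1 - 1 / real k) / real n) ^ k = x ^ k * (real n powr (- (1 / real k))) ^ k"
    by (metis power_mult_distrib times_divide_eq_right)
  also have "(real n powr (- (1 / real k))) ^ k = 1 / real n"
  proof -
    have "(real n powr (- (1 / real k))) ^ k = (real n powr (- (1 / real k))) powr real k"
      using assms by (simp add: powr_realpow)
    also have "\<dots> = real n powr (- 1)" unfolding powr_powr using assms(1) by simp
    finally show ?thesis using assms(2) by (simp add: powr_minus_divide)
  qed
  finally show ?thesis using assms(2) by simp
qed

text \<open>Capping at \<open>n\<close> provides rounds of at most \<open>n\<close> edges, for which
  \<open>tree_count\<close> decreases in the number of edges of the tree. Dividing by
  \<open>Suc d\<close> lets \<open>d\<close> rounds fit into the game and covers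
  \<open>d = 0\<close>.\<close>

lemma eventually_tree_count_large:
  assumes "k > 0" and N: "(\<lambda>n. real (N n)) \<in> \<omega>(\<lambda>n. real n powr (1 - 1 / real k))"
  shows "eventually (\<lambda>n. 0 < min (N n) n div Suc d \<and> L \<le> tree_count n (min (N n) n div Suc d) k) sequentially"
proof -
  \<comment> \<open>\<open>L' \<ge> 1\<close> gives \<open>L' \<le> L' ^ k\<close>; the factor 2 in
    \<open>c\<close> below pays for rounding down in the division by \<open>Suc d\<close>.\<close>
  define L' where "L' = max L 1"
  define c where "c = 2 * real (Suc d) * L'"
  have c: "c > 0" "L' \<ge> 1" "L \<le> L'" by (auto simp: c_def L'_def)
  let ?g = "\<lambda>n. real n powr (1 - 1 / real k)"
  have "filterlim (\<lambda>n. real n powr (1 / real k)) at_top sequentially"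
    using assms(1) by real_asymp
  then have 1: "eventually (\<lambda>n. c \<le> real n powr (1 / real k)) sequentially"
    by (simp add: filterlim_at_top)
  have 2: "eventually (\<lambda>n. norm (real (N n)) \<ge> c * norm (?g n)) sequentially"
    using landau_omega.smallD[OF N c(1)] by simp
  show ?thesis using 1 2 eventually_gt_at_top[of 0]
  proof eventually_elim
    case (elim n)
    let ?m = "min (N n) n div Suc d"
    have g1: "1 \<le> ?g n" using elim(3) assms(1) by (intro ge_one_powr_ge_zero) auto
    have "real n = real n powr (1 / real k) * ?g n"
      using elim(3) by (simp add: powr_add[symmetric])
    moreover have "c * ?g n \<le> real n powr (1 / real k) * ?g n"
      using elim(1) by (intro mult_right_mono) auto
    ultimately have "c * ?g n \<le> real (min (N n) n)" using elim(2) by (auto simp: min_def)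
    moreover have "real (min (N n) n) < real (Suc d) * (real ?m + 1)"
      by (metis of_nat_1 of_nat_add of_nat_less_iff of_nat_mult Suc_eq_plus1
          dividend_less_times_div mult_Suc_right add.commute zero_less_Suc)
    ultimately have "c * ?g n < real (Suc d) * (real ?m + 1)" by linarith
    moreover have "c * ?g n = real (Suc d) * (2 * L' * ?g n)" unfolding c_def by (simp only: mult_ac)
    ultimately have "real (Suc d) * (2 * L' * ?g n) < real (Suc d) * (real ?m + 1)" by simp
    then have "2 * L' * ?g n < real ?m + 1" by (rule mult_left_less_imp_less) simp
    moreover have Lg: "1 \<le> L' * ?g n" using mult_mono[OF c(2) g1] c(2) by simp
    ultimately have m: "L' * ?g n \<le> real ?m" by linarith
    have "L' \<le> L' ^ k" using c(2) assms(1) by (simp add: self_le_power)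
    also have "\<dots> = real n * (L' * ?g n / real n) ^ k" using tree_count_scale[OF assms(1) elim(3)] by simp
    also have "\<dots> \<le> tree_count n ?m k"
      unfolding tree_count_def using m Lg c(2)
      by (intro mult_left_mono power_mono divide_right_mono) auto
    finally show ?case using c(3) m Lg by auto
  qed
qed

lemma force_imp_aas_creates:
  assumes "force V E r a k d []" "r > 0" "k > 0"
    and N: "(\<lambda>n. real (N n)) \<in> \<omega>(\<lambda>n. real n powr (1 - 1 / real k))"
    and \<sigma>: "\<And>n. painter_strategy r (\<sigma> n)"
  shows "aas_creates V E \<sigma> N"
  unfolding aas_creates_def
proof (rule prob_tendsto_1)
  fix \<eta> :: real assume "\<eta> > 0"
  have "card (component_edges (board_edges []) v) \<le> k" for v by (simp add: component_edges_def)
  then obtain L where L: "\<And>n m \<sigma> h t. \<lbrakk>0 < m; m \<le> n; L \<le> tree_count n m k; painter_strategy r \<sigma>;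
      snd ` set h \<subseteq> {..<r}; abundant n m a 1 [] h; d * m \<le> t\<rbrakk> \<Longrightarrow>
      measure (measure_pmf (game_from n \<sigma> h t)) {h'. \<not> mono_copy V E n h'} \<le> \<eta>"
    using force_succeeds[OF assms(1) legal_play_Nil assms(2) zero_less_one \<open>\<eta> > 0\<close>] by blast
  show "eventually (\<lambda>n. measure (measure_pmf (random_game n (\<sigma> n) (N n)))
      {h. \<not> mono_copy V E n h} \<le> \<eta>) sequentially"
    using eventually_tree_count_large[OF assms(3) N, of d L]
  proof eventually_elim
    case (elim n)
    let ?m = "min (N n) n div Suc d"
    have "?m \<le> n" by (meson div_le_dividend le_trans min.cobounded2)
    moreover have "d * ?m \<le> N n"
    proof -
      have "d * ?m \<le> ?m * Suc d" by simp
      also have "\<dots> \<le> min (N n) n" by (rule div_times_less_eq_dividend)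
      finally show ?thesis by simp
    qed
    ultimately show ?case unfolding random_game_eq
      by (intro L[OF _ _ _ \<sigma> _ abundant_Nil]) (use elim in auto)
  qed
qed

section \<open>Lower bound on the threshold\<close>

lemma power_Suc_add_one_le: "0 \<le> (x::real) \<Longrightarrow> x ^ Suc j + real (Suc j) * x ^ j \<le> (x + 1) ^ Suc j"
proof (induction j)
  case (Suc j)
  have "0 \<le> real (Suc j) * x ^ j" using Suc.prems by simp
  then have "x ^ Suc (Suc j) + real (Suc (Suc j)) * x ^ Suc j \<le> (x + 1) * (x ^ Suc j + real (Suc j) * x ^ j)"
    by (simp add: algebra_simps)
  also have "\<dots> \<le> (x + 1) * (x + 1) ^ Suc j" using Suc by (intro mult_left_mono) auto
  finally show ?case by simp
qed simp

lemma game_from_Nil_board: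
  assumes "h \<in> set_pmf (game_from n \<sigma> [] t)"
  shows "board_edges h \<subseteq> all_edges {..<n}" "card (board_edges h) \<le> t"
proof -
  show "board_edges h \<subseteq> all_edges {..<n}"
    by (rule game_from_invariant[OF assms]) auto
  show "card (board_edges h) \<le> t" using assms
  proof (induction t arbitrary: h)
    case (Suc t)
    then obtain g where g: "g \<in> set_pmf (game_from n \<sigma> [] t)" "h \<in> set_pmf (game_step n \<sigma> g)" by auto
    then show ?case using game_step_cases[OF g(2)] Suc.IH[OF g(1)] by auto
  qed simp
qed

text \<open>After one more step \<open>D\<close> is present only if it was there before, or if some
  \<open>D - {e}\<close> was and \<open>e\<close> has just been drawn, which has probability at most
  \<open>1 / b\<close>. The sum yields the first two terms of the binomial expansion of
  \<open>(t + 1) ^ Suc j\<close>. Fixing \<open>T\<close> apart from \<open>t\<close> keeps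
  \<open>b\<close> constant during the induction.\<close>

lemma edges_on_board_prob:
  assumes "t \<le> T" "T < card (all_edges {..<n})" "finite D"
  shows "measure (measure_pmf (game_from n \<sigma> [] t)) {h. D \<subseteq> board_edges h} \<le>
    (real t / real (card (all_edges {..<n}) - T)) ^ card D"
  using assms(1,3)
proof (induction t arbitrary: D)
  case 0
  show ?case
  proof (cases "D = {}")
    case False
    then have "measure (measure_pmf (game_from n \<sigma> [] 0)) {h. D \<subseteq> board_edges h} = 0"
      by (intro measure_pmf_eq_0I) auto
    then show ?thesis by simp
  qed simp
next
  case (Suc t)
  define b where "b = real (card (all_edges {..<n}) - T)"
  have b: "b > 0" using assms(2) by (simp add: b_def)
  let ?p = "game_from n \<sigma> [] t"
  let ?A = "\<lambda>D. {h. D \<subseteq> board_edges h}"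
  show ?case
  proof (cases "D = {}")
    case True
    then show ?thesis using measure_pmf.prob_le_1 by simp
  next
    case False
    then obtain j where j: "card D = Suc j" using Suc.prems(2) by (metis card_0_eq not0_implies_Suc)
    have step: "measure (measure_pmf (game_step n \<sigma> h)) (?A D) \<le>
        indicator (?A D) h + (\<Sum>e\<in>D. indicator (?A (D - {e})) h / b)" if h: "h \<in> set_pmf ?p" for h
    proof (cases "D \<subseteq> board_edges h")
      case True
      then show ?thesis using b
        by (auto intro!: order.trans[OF measure_pmf.prob_le_1] sum_nonneg)
    next
      case notD: False
      define S where "S = all_edges {..<n} - board_edges h"
      have "card S = card (all_edges {..<n}) - card (board_edges h)"
        unfolding S_def using game_from_Nil_board[OF h] by (intro card_Diff_subset) auto
      then have "card (all_edges {..<n}) - T \<le> card S"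
        using game_from_Nil_board(2)[OF h] Suc.prems(1) by linarith
      then have bS: "b \<le> real (card S)" by (simp add: b_def)
      have "0 < card S" using bS b by linarith
      then have S: "finite S" "S \<noteq> {}" by (auto simp: card_gt_0_iff)
      have "game_step n \<sigma> h = map_pmf (\<lambda>e. h @ [(e, \<sigma> h e)]) (pmf_of_set S)"
        using S(2) by (simp add: game_step_def S_def Let_def)
      then have "measure (measure_pmf (game_step n \<sigma> h)) (?A D) =
          real (card (S \<inter> {e. D \<subseteq> insert e (board_edges h)})) / real (card S)"
        using S by (simp add: measure_map_pmf vimage_def measure_pmf_of_set)
      also have "\<dots> \<le> real (card {e \<in> D. D - {e} \<subseteq> board_edges h}) / b"
      proof (intro frac_le)
        have "S \<inter> {e. D \<subseteq> insert e (board_edges h)} \<subseteq> {e \<in> D. D - {e} \<subseteq> board_edges h}"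
          using notD by auto
        then show "real (card (S \<inter> {e. D \<subseteq> insert e (board_edges h)})) \<le>
            real (card {e \<in> D. D - {e} \<subseteq> board_edges h})"
          using Suc.prems(2) by (auto intro!: card_mono)
      qed (use b bS in auto)
      also have "\<dots> = (\<Sum>e\<in>D. indicator (?A (D - {e})) h / b)"
        using Suc.prems(2)
        by (simp add: sum_divide_distrib[symmetric] indicator_def sum.If_cases Int_def)
      finally show ?thesis using notD by simp
    qed
    have int: "integrable (measure_pmf ?p) (\<lambda>h. indicator (?A D') h :: real)" for D'
      by (simp add: measure_pmf.emeasure_eq_measure)
    have "measure (measure_pmf (game_from n \<sigma> [] (Suc t))) (?A D) =
        (\<integral>h. measure (measure_pmf (game_step n \<sigma> h)) (?A D) \<partial>measure_pmf ?p)"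
      by (simp add: measure_bind_pmf)
    also have "\<dots> \<le> (\<integral>h. indicator (?A D) h + (\<Sum>e\<in>D. indicator (?A (D - {e})) h / b) \<partial>measure_pmf ?p)"
    proof (rule integral_mono_AE)
      show "integrable (measure_pmf ?p) (\<lambda>h. measure (measure_pmf (game_step n \<sigma> h)) (?A D))"
        by (rule measure_pmf.integrable_const_bound[where B = 1]) auto
      show "integrable (measure_pmf ?p) (\<lambda>h. indicator (?A D) h + (\<Sum>e\<in>D. indicator (?A (D - {e})) h / b))"
        using int by (intro Bochner_Integration.integrable_add Bochner_Integration.integrable_sum
            integrable_divide) auto
    qed (use step in \<open>auto simp: AE_measure_pmf_iff\<close>)
    also have "\<dots> = measure (measure_pmf ?p) (?A D) + (\<Sum>e\<in>D. measure (measure_pmf ?p) (?A (D - {e})) / b)"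
      using int by (simp add: integrable_divide)
    also have "\<dots> \<le> (real t / b) ^ Suc j + (\<Sum>e\<in>D. (real t / b) ^ j / b)"
    proof (intro add_mono sum_mono divide_right_mono)
      show "measure (measure_pmf ?p) (?A D) \<le> (real t / b) ^ Suc j"
        using Suc.IH[of D] Suc.prems j by (simp add: b_def)
      fix e assume "e \<in> D"
      then have "card (D - {e}) = j" using j Suc.prems(2) by simp
      then show "measure (measure_pmf ?p) (?A (D - {e})) \<le> (real t / b) ^ j"
        using Suc.IH[of "D - {e}"] Suc.prems by (simp add: b_def)
    qed (use b in simp)
    also have "\<dots> = (real t ^ Suc j + real (Suc j) * real t ^ j) / b ^ Suc j"
      using b j by (simp add: power_divide field_simps)
    also have "\<dots> \<le> (real t + 1) ^ Suc j / b ^ Suc j"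
      using b by (intro divide_right_mono power_Suc_add_one_le) auto
    also have "\<dots> = (real (Suc t) / b) ^ card D" using j by (simp add: power_divide add.commute)
    finally show ?thesis by (simp add: b_def)
  qed
qed

text \<open>The list may repeat vertices, so \<open>w\<close> is an upper bound on the size of the
  spot, and there are exactly \<open>n ^ w\<close> lists.\<close>

definition dense_spot :: "nat \<Rightarrow> nat \<Rightarrow> nat \<Rightarrow> nat set set \<Rightarrow> bool" where
  "dense_spot n w j B \<longleftrightarrow> (\<exists>vs D. set vs \<subseteq> {..<n} \<and> length vs = w \<and> D \<subseteq> Pow (set vs) \<and> card D = j \<and> D \<subseteq> B)"

text \<open>Union bound over the vertex lists and, for each, over at most \<open>2 ^ 2 ^ w\<close>
  sets of subsets of its entries.\<close>

lemma dense_spot_prob: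
  assumes "t < card (all_edges {..<n})"
  shows "measure (measure_pmf (game_from n \<sigma> [] t)) {h. dense_spot n w j (board_edges h)} \<le>
    real n ^ w * 2 ^ 2 ^ w * (real t / real (card (all_edges {..<n}) - t)) ^ j"
proof -
  let ?p = "game_from n \<sigma> [] t" and ?q = "(real t / real (card (all_edges {..<n}) - t)) ^ j"
  define Ls where "Ls = {vs. set vs \<subseteq> {..<n} \<and> length vs = w}"
  define Ds where "Ds vs = {D. D \<subseteq> Pow (set vs) \<and> card D = j}" for vs :: "nat list"
  have finL: "finite Ls" unfolding Ls_def by (rule finite_lists_length_eq) simp
  have cL: "card Ls = n ^ w" unfolding Ls_def using card_lists_length_eq[of "{..<n}" w] by simp
  have finD: "finite (Ds vs)" for vs by (simp add: Ds_def)
  have cD: "card (Ds vs) \<le> 2 ^ 2 ^ w" if "vs \<in> Ls" for vs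
  proof -
    have "card (Ds vs) \<le> card (Pow (Pow (set vs)))" by (intro card_mono) (auto simp: Ds_def)
    also have "\<dots> = 2 ^ 2 ^ card (set vs)" by (simp add: card_Pow)
    also have "\<dots> \<le> 2 ^ 2 ^ w"
      using that card_length[of vs] by (intro power_increasing) (auto simp: Ls_def)
    finally show ?thesis .
  qed
  have "{h. dense_spot n w j (board_edges h)} = (\<Union>(vs, D)\<in>Sigma Ls Ds. {h. D \<subseteq> board_edges h})"
    unfolding dense_spot_def Ls_def Ds_def by blast
  then have "measure (measure_pmf ?p) {h. dense_spot n w j (board_edges h)} \<le>
      (\<Sum>x\<in>Sigma Ls Ds. measure (measure_pmf ?p) {h. snd x \<subseteq> board_edges h})"
    using measure_pmf.finite_measure_subadditive_finite[of "Sigma Ls Ds" "\<lambda>x. {h. snd x \<subseteq> board_edges h}" ?p]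
      finL finD by (auto simp: case_prod_beta)
  also have "\<dots> \<le> (\<Sum>x\<in>Sigma Ls Ds. ?q)"
  proof (rule sum_mono)
    fix x assume "x \<in> Sigma Ls Ds"
    then have x: "snd x \<subseteq> Pow (set (fst x))" "card (snd x) = j" unfolding Ds_def by force+
    then have "finite (snd x)" by (meson List.finite_set finite_Pow_iff finite_subset)
    from edges_on_board_prob[OF order.refl assms this, of \<sigma>] x(2)
    show "measure (measure_pmf ?p) {h. snd x \<subseteq> board_edges h} \<le> ?q" by simp
  qed
  also have "\<dots> = real (card (Sigma Ls Ds)) * ?q" by simp
  also have "\<dots> \<le> real (n ^ w * 2 ^ 2 ^ w) * ?q"
  proof (intro mult_right_mono)
    have "card (Sigma Ls Ds) = (\<Sum>vs\<in>Ls. card (Ds vs))" using finL finD by simp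
    also have "\<dots> \<le> (\<Sum>vs\<in>Ls. 2 ^ 2 ^ w)" by (rule sum_mono[OF cD])
    finally show "real (card (Sigma Ls Ds)) \<le> real (n ^ w * 2 ^ 2 ^ w)" 
      unfolding of_nat_le_iff by (simp add: cL)
  qed simp
  finally show ?thesis by simp
qed

text \<open>Grow from \<open>v\<close>, always adding an edge that touches the vertices reached so
  far, so that each edge brings at most one new vertex. If no further edge touches them, they are
  the whole component and all its edges are used.\<close>

lemma connected_growth:
  assumes "B \<subseteq> all_edges A" "finite B" "j \<le> card (component_edges B v)"
  shows "\<exists>D X. D \<subseteq> component_edges B v \<and> card D = j \<and> v \<in> X \<and> X \<subseteq> component B v \<and>
    finite X \<and> card X \<le> Suc j \<and> \<Union>D \<subseteq> X"
  using assms(3)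
proof (induction j)
  case 0
  then show ?case by (intro exI[of _ "{}"] exI[of _ "{v}"]) auto
next
  case (Suc j)
  then obtain D X where D: "D \<subseteq> component_edges B v" "card D = j" "v \<in> X" "X \<subseteq> component B v"
    "finite X" "card X \<le> Suc j" "\<Union>D \<subseteq> X" by auto
  have fin: "finite (component_edges B v)" using assms(2) by (simp add: component_edges_def)
  have finD: "finite D" by (rule finite_subset[OF D(1) fin])
  have edge: "card e = 2" if "e \<in> B" for e using that assms(1) by (auto simp: all_edges_def)
  have "\<exists>e \<in> component_edges B v - D. e \<inter> X \<noteq> {}"
  proof (rule ccontr)
    assume none: "\<not> (\<exists>e \<in> component_edges B v - D. e \<inter> X \<noteq> {})"
    have "component B v \<subseteq> X"
    proof (rule component_closed_subset[OF D(3)])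
      fix x y assume xy: "x \<in> X" "{x, y} \<in> B"
      have "x \<in> component B v" using D(4) xy(1) by blast
      then have "{x, y} \<in> component_edges B v"
        using component_step[of x B v y] xy(2) by (auto simp: component_edges_def)
      moreover have "{x, y} \<inter> X \<noteq> {}" using xy(1) by auto
      ultimately have "{x, y} \<in> D" using none by (metis DiffI)
      then show "y \<in> X" using D(7) by auto
    qed
    have "component_edges B v \<subseteq> D"
    proof
      fix e assume e: "e \<in> component_edges B v"
      then have "e \<subseteq> X" "card e = 2" using \<open>component B v \<subseteq> X\<close> edge by (auto simp: component_edges_def)
      then have "e \<inter> X \<noteq> {}" by (auto simp: Int_absorb2)
      then show "e \<in> D" using none e by (metis DiffI)
    qed
    then have "card (component_edges B v) \<le> j" using D(2) finD card_mono by metis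
    then show False using Suc.prems by simp
  qed
  then obtain e where e: "e \<in> component_edges B v" "e \<notin> D" "e \<inter> X \<noteq> {}" by blast
  have eC: "e \<subseteq> component B v" "card e = 2" using e(1) edge by (auto simp: component_edges_def)
  obtain x y where xy: "e = {x, y}" "x \<in> X" using eC(2) e(3) by (auto simp: card_2_iff)
  have "card (insert y X) \<le> Suc (Suc j)" using D(5,6) card_insert_le_m1[of "Suc (Suc j)" X y] by simp
  then show ?case
    using D e eC xy finD by (intro exI[of _ "insert e D"] exI[of _ "insert y X"]) auto
qed

lemma large_component_dense:
  assumes "B \<subseteq> all_edges {..<n}" "v < n" "k \<le> card (component_edges B v)"
  shows "dense_spot n (Suc k) k B"
proof -
  have finB: "finite B" by (rule finite_subset[OF assms(1)]) simp
  have Cn: "component B v \<subseteq> {..<n}" by (rule component_closed_subset) (use assms in auto)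
  obtain D X where D: "D \<subseteq> component_edges B v" "card D = k" "v \<in> X" "X \<subseteq> component B v"
    "finite X" "card X \<le> Suc k" "\<Union>D \<subseteq> X"
    using connected_growth[OF assms(1) finB assms(3)] by blast
  obtain xs where xs: "set xs = X" "distinct xs" using finite_distinct_list[OF D(5)] by blast
  then have len: "length xs \<le> Suc k" using distinct_card[OF xs(2)] D(6) by simp
  \<comment> \<open>Repeating \<open>v\<close> pads the list to the exact length that
    \<open>dense_spot\<close> asks for.\<close>
  let ?vs = "xs @ replicate (Suc k - length xs) v"
  have "set ?vs = X" using xs(1) D(3) by auto
  moreover have "length ?vs = Suc k" using len by simp
  moreover have "X \<subseteq> {..<n}" using D(4) Cn by blast
  moreover have "D \<subseteq> Pow X" using D(7) by blast
  moreover have "D \<subseteq> B" using D(1) by (auto simp: component_edges_def)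
  ultimately show ?thesis using D(2) unfolding dense_spot_def
    by (intro exI[of _ ?vs] exI[of _ D]) simp
qed

text \<open>If all components have fewer than \<open>k\<close> edges, a cycle is also shorter than
  \<open>k\<close>, since its edges lie in one component. So boundedly many kinds of spots account
  for all illegal boards, as a union bound requires.\<close>

lemma illegal_imp_dense:
  assumes B: "B \<subseteq> all_edges {..<n}" and "k > 0"
    and ill: "\<not> (acyclic_graph B \<and> (\<forall>v<n. card (component_edges B v) \<le> k - 1))"
  shows "dense_spot n (Suc k) k B \<or> (\<exists>l\<in>{1..k}. dense_spot n l l B)"
proof (cases "\<exists>v<n. k \<le> card (component_edges B v)")
  case True
  then show ?thesis using large_component_dense[OF B] by blast
next
  case False
  then have "\<forall>v<n. card (component_edges B v) \<le> k - 1" by auto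
  then obtain vs where c: "cycle B vs" using ill by (auto simp: acyclic_graph_def)
  define l where "l = length vs"
  define ed where "ed i = {vs ! i, vs ! (Suc i mod l)}" for i
  have l: "3 \<le> l" "distinct vs" "\<And>i. i < l \<Longrightarrow> ed i \<in> B" using c by (auto simp: cycle_def l_def ed_def)
  have inj: "inj_on ed {..<l}" using inj_on_cycle_edges[of vs] l unfolding ed_def l_def by blast
  then have card: "card (ed ` {..<l}) = l" by (simp add: card_image)
  have vsn: "vs ! i < n" if "i < l" for i using l(3)[OF that] B by (auto simp: ed_def)
  have sub: "ed i \<subseteq> set vs" if "i < l" for i
  proof -
    have "Suc i mod l < l" using l(1) by simp
    then show ?thesis using that by (auto simp: ed_def l_def)
  qed
  have "l \<le> k"
  proof (rule ccontr)
    assume "\<not> l \<le> k"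
    have reach: "vs ! i \<in> component B (vs ! 0)" if "i < l" for i
      using that
    proof (induction i)
      case (Suc i)
      then have "{vs ! i, vs ! Suc i} \<in> B" using l(3)[of i] by (simp add: ed_def)
      then show ?case using Suc component_step by auto
    qed simp
    have "ed i \<in> component_edges B (vs ! 0)" if "i < l" for i
      using reach[OF that] reach[of "Suc i mod l"] l(1) l(3)[OF that] by (simp add: component_edges_def ed_def)
    then have "card (ed ` {..<l}) \<le> card (component_edges B (vs ! 0))"
      using finite_subset[OF B] by (intro card_mono) (auto simp: component_edges_def)
    then show False using False vsn[of 0] l(1) card \<open>\<not> l \<le> k\<close> by auto
  qed
  moreover have "dense_spot n l l B" unfolding dense_spot_def
    by (intro exI[of _ vs] exI[of _ "ed ` {..<l}"])
      (use vsn sub l card in \<open>auto simp: l_def in_set_conv_nth\<close>)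
  ultimately show ?thesis using l(1) by auto
qed

text \<open>Both conditions pass to smaller boards, so if the final board satisfies them, the board
  was legal after every move.\<close>

lemma random_game_legal:
  assumes "h \<in> set_pmf (game_from n \<sigma> [] t)"
  shows "painter_follows \<sigma> h"
    and "acyclic_graph (board_edges h) \<Longrightarrow> \<forall>v<n. card (component_edges (board_edges h) v) \<le> k \<Longrightarrow>
      legal_play n k h"
proof -
  show "painter_follows \<sigma> h" by (rule game_from_invariant[OF assms]) auto
  let ?good = "\<lambda>B. acyclic_graph B \<and> (\<forall>v<n. card (component_edges B v) \<le> k)"
  have "?good (board_edges h) \<longrightarrow> legal_play n k h"
  proof (rule game_from_invariant[OF assms])
    fix g e assume IH: "?good (board_edges g) \<longrightarrow> legal_play n k g"
      and e: "e \<in> all_edges {..<n} - board_edges g"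
    show "?good (board_edges (g @ [(e, \<sigma> g e)])) \<longrightarrow> legal_play n k (g @ [(e, \<sigma> g e)])"
    proof
      assume good: "?good (board_edges (g @ [(e, \<sigma> g e)]))"
      have "card (component_edges (board_edges g) v) \<le> card (component_edges (insert e (board_edges g)) v)" for v
        by (intro card_mono component_edges_mono) (auto simp: component_edges_def)
      then have "?good (board_edges g)"
        using good acyclic_subset[of "insert e (board_edges g)" "board_edges g"]
        by (auto intro: order.trans)
      then show "legal_play n k (g @ [(e, \<sigma> g e)])" using IH good e by (simp add: legal_move_def)
    qed
  qed simp
  then show "acyclic_graph (board_edges h) \<Longrightarrow> \<forall>v<n. card (component_edges (board_edges h) v) \<le> k \<Longrightarrow>
      legal_play n k h" by blast
qed

section \<open>Size of the complete board and the final union bound\<close>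

lemma card_all_edges: "card (all_edges {..<n}) = n choose 2"
  unfolding all_edges_def using n_subsets[of "{..<n}" 2] by simp

lemma card_all_edges_ge:
  assumes "16 \<le> n" "t \<le> n"
  shows "t < card (all_edges {..<n})" "real n * real n / 8 \<le> real (card (all_edges {..<n}) - t)"
proof -
  have "real (card (all_edges {..<n})) = real n * (real n - 1) / 2"
    unfolding card_all_edges choose_two using assms(1) by (simp add: real_of_nat_div of_nat_diff)
  moreover have "16 * real n \<le> real n * real n" using assms(1) by (intro mult_right_mono) auto
  moreover have "0 < real n" "real n * (real n - 1) = real n * real n - real n"
    using assms(1) by (auto simp: algebra_simps)
  ultimately have *: "real n * real n / 8 + real n < real (card (all_edges {..<n}))" by linarith
  have "0 \<le> real n * real n / 8" by simp
  then show "t < card (all_edges {..<n})" using * assms(2) by linarith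
  then show "real n * real n / 8 \<le> real (card (all_edges {..<n}) - t)"
    using * assms(2) by (simp add: of_nat_diff)
qed

lemma painter_winning_aas_avoids:
  assumes win: "painter_winning V E r (k - 1) \<pi>" and "k > 0"
    and N: "(\<lambda>n. real (N n)) \<in> o(\<lambda>n. real n powr (1 - 1 / real k))"
  shows "aas_avoids V E \<pi> N"
  unfolding aas_avoids_def
proof (rule prob_tendsto_1)
  fix \<eta> :: real assume \<eta>: "\<eta> > 0"
  let ?g = "\<lambda>n. real n powr (1 - 1 / real k)"
  \<comment> \<open>\<open>2 ^ 2 ^ Suc k\<close> bounds the number of edge sets of a spot;
    \<open>8 ^ k\<close> comes from the at least n^2 / 8 pairs that remain free.\<close>
  define K :: real where "K = 2 ^ 2 ^ Suc k * 8 ^ k"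
  have K: "K > 0" by (simp add: K_def)
  \<comment> \<open>There are \<open>k + 1\<close> kinds of spots, one for trees and
    \<open>k\<close> for cycle lengths, each of probability at most \<open>K * c\<close>;
    \<open>c \<le> 1\<close> bounds powers of \<open>c\<close> by \<open>c\<close>.\<close>
  define c where "c = min 1 (\<eta> / (real (Suc k) * K))"
  have c: "0 < c" "c \<le> 1" "real (Suc k) * (K * c) \<le> \<eta>"
  proof -
    have pos: "0 < real (Suc k) * K" using K by simp
    then show "0 < c" "c \<le> 1" unfolding c_def using \<eta> by (auto intro: divide_pos_pos)
    have "real (Suc k) * K * c \<le> real (Suc k) * K * (\<eta> / (real (Suc k) * K))"
      using pos by (intro mult_left_mono) (auto simp: c_def)
    then show "real (Suc k) * (K * c) \<le> \<eta>" using K by (simp add: mult.assoc)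
  qed
  have ev: "eventually (\<lambda>n. norm (real (N n)) \<le> c * norm (?g n)) sequentially"
    using landau_o.smallD[OF N c(1)] by simp
  show "eventually (\<lambda>n. measure (measure_pmf (random_game n (\<pi> n) (N n)))
      {h. \<not> \<not> mono_copy V E n h} \<le> \<eta>) sequentially"
    using ev eventually_ge_at_top[of 16]
  proof eventually_elim
    case (elim n)
    let ?p = "game_from n (\<pi> n) [] (N n)"
    have n: "0 < n" "0 < real n" using elim(2) by auto
    have Nc: "real (N n) \<le> c * ?g n" using elim(1) by simp
    \<comment> \<open>The threshold is at most \<open>n\<close>, so \<open>N n \<le> c * n\<close>,
      which is what makes cycles unlikely.\<close>
    have "?g n \<le> real n powr 1" using n(2) elim(2) by (intro powr_mono) auto
    then have g: "?g n \<le> real n" using n by simp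
    have "c * ?g n \<le> c * real n" using g c(1) by (intro mult_left_mono) auto
    then have Ncn: "real (N n) \<le> c * real n" using Nc by linarith
    also have "\<dots> \<le> real n" using mult_right_mono[OF c(2), of "real n"] by simp
    finally have "N n \<le> n" by simp
    note ce = card_all_edges_ge[OF elim(2) this]
    let ?q = "real (N n) / real (card (all_edges {..<n}) - N n)"
    have "?q \<le> real (N n) / (real n * real n / 8)"
      using ce n by (intro divide_left_mono) auto
    then have q: "?q \<le> 8 * (real (N n) / real n) / real n" by (simp add: field_simps)
    have q0: "0 \<le> ?q" by simp
    have spot: "measure (measure_pmf ?p) {h. dense_spot n w j (board_edges h)} \<le> K * c"
      if "w \<le> Suc k" "j \<le> k" and wj: "real n ^ w * ((real (N n) / real n) / real n) ^ j \<le> c" for w j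
    proof -
      have "measure (measure_pmf ?p) {h. dense_spot n w j (board_edges h)} \<le>
          real n ^ w * 2 ^ 2 ^ w * ?q ^ j"
        by (rule dense_spot_prob[OF ce(1)])
      also have "\<dots> \<le> real n ^ w * 2 ^ 2 ^ w * (8 * (real (N n) / real n) / real n) ^ j"
        using power_mono[OF q q0] by (intro mult_left_mono) auto
      also have "\<dots> = 2 ^ 2 ^ w * 8 ^ j * (real n ^ w * ((real (N n) / real n) / real n) ^ j)"
        by (simp add: power_mult_distrib power_divide)
      also have "\<dots> \<le> K * c"
        unfolding K_def using that by (intro mult_mono power_increasing) (auto intro!: mult_nonneg_nonneg)
      finally show ?thesis .
    qed
    have tree: "measure (measure_pmf ?p) {h. dense_spot n (Suc k) k (board_edges h)} \<le> K * c"
    proof (rule spot)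
      have "real n ^ Suc k * ((real (N n) / real n) / real n) ^ k = real n * (real (N n) / real n) ^ k"
        using n by (simp add: power_divide power_mult_distrib)
      also have "\<dots> \<le> real n * (c * ?g n / real n) ^ k"
        using Nc n by (intro mult_left_mono power_mono divide_right_mono) auto
      also have "\<dots> = c ^ k" by (rule tree_count_scale[OF \<open>k > 0\<close> n(1)])
      also have "\<dots> \<le> c ^ 1" using c \<open>k > 0\<close> by (intro power_decreasing) auto
      finally show "real n ^ Suc k * ((real (N n) / real n) / real n) ^ k \<le> c" by simp
    qed auto
    have cyc: "measure (measure_pmf ?p) {h. dense_spot n l l (board_edges h)} \<le> K * c" if l: "l \<in> {1..k}" for l
    proof (rule spot)
      have "real n ^ l * ((real (N n) / real n) / real n) ^ l = (real (N n) / real n) ^ l"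
        using n by (simp add: power_divide power_mult_distrib)
      also have "\<dots> \<le> c ^ l" using Ncn n by (intro power_mono) (auto simp: field_simps)
      also have "\<dots> \<le> c ^ 1" using c l by (intro power_decreasing) auto
      finally show "real n ^ l * ((real (N n) / real n) / real n) ^ l \<le> c" by simp
    qed (use l in auto)
    have avoid: "\<not> mono_copy V E n h" if h: "h \<in> set_pmf ?p" and nd: "\<not> dense_spot n (Suc k) k (board_edges h)"
      "\<And>l. l \<in> {1..k} \<Longrightarrow> \<not> dense_spot n l l (board_edges h)" for h
    proof -
      have "legal_play n (k - 1) h"
        using random_game_legal(2)[OF h] nd illegal_imp_dense[OF game_from_Nil_board(1)[OF h] \<open>k > 0\<close>] by blast
      then show ?thesis using win random_game_legal(1)[OF h] unfolding painter_winning_def by blast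
    qed
    have "measure (measure_pmf ?p) {h. mono_copy V E n h} \<le>
        measure (measure_pmf ?p) ({h. dense_spot n (Suc k) k (board_edges h)} \<union>
          (\<Union>l\<in>{1..k}. {h. dense_spot n l l (board_edges h)}))"
    proof (rule measure_pmf.finite_measure_mono_AE)
      show "AE h in measure_pmf ?p. h \<in> {h. mono_copy V E n h} \<longrightarrow>
          h \<in> {h. dense_spot n (Suc k) k (board_edges h)} \<union>
            (\<Union>l\<in>{1..k}. {h. dense_spot n l l (board_edges h)})"
        unfolding AE_measure_pmf_iff
      proof (intro ballI impI)
        fix h assume "h \<in> set_pmf ?p" "h \<in> {h. mono_copy V E n h}"
        then show "h \<in> {h. dense_spot n (Suc k) k (board_edges h)} \<union>
            (\<Union>l\<in>{1..k}. {h. dense_spot n l l (board_edges h)})"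
          using avoid[of h] by blast
      qed
    qed simp
    also have "\<dots> \<le> measure (measure_pmf ?p) {h. dense_spot n (Suc k) k (board_edges h)} +
        measure (measure_pmf ?p) (\<Union>l\<in>{1..k}. {h. dense_spot n l l (board_edges h)})"
      by (rule measure_Un_le) auto
    also have "\<dots> \<le> K * c + (\<Sum>l\<in>{1..k}. measure (measure_pmf ?p) {h. dense_spot n l l (board_edges h)})"
      by (intro add_mono tree measure_pmf.finite_measure_subadditive_finite) auto
    also have "\<dots> \<le> K * c + (\<Sum>l\<in>{1..k}. K * c)"
      using cyc by (intro add_left_mono sum_mono) auto
    also have "\<dots> = real (Suc k) * (K * c)" by (simp add: algebra_simps)
    also have "\<dots> \<le> \<eta>" by (rule c(3))
    finally show ?case by (simp add: random_game_eq)
  qed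
qed

section \<open>The threshold\<close>

theorem theorem5:
  fixes V :: "'a set" and E :: "'a set set" and r :: nat
  assumes "forest V E" and "E \<noteq> {}" and "r \<ge> 2"
  shows "is_threshold V E r (\<lambda>n. real n powr (1 - 1 / real (kstar V E r))) \<and>
    (\<forall>\<pi>. painter_winning V E r (kstar V E r - 1) \<pi> \<longrightarrow>
       (\<forall>N. (\<lambda>n. real (N n)) \<in> o(\<lambda>n. real n powr (1 - 1 / real (kstar V E r))) \<longrightarrow>
          aas_avoids V E \<pi> N))"
proof -
  let ?k = "kstar V E r"
  have r: "r > 0" using assms(3) by simp
  have wins: "builder_wins V E r ?k"
    unfolding kstar_def using builder_wins_exists[OF assms(1) r] by (rule LeastI_ex)
  then have k: "?k > 0" using not_builder_wins_0[OF assms(2) r] by (metis gr0I)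
  \<comment> \<open>Minimality of \<open>kstar\<close>; determinacy then supplies a winning Painter
    strategy for the predecessor.\<close>
  have "\<not> builder_wins V E r (?k - 1)"
    unfolding kstar_def by (rule not_less_Least) (use k in \<open>simp add: kstar_def\<close>)
  from painter_winning_exists[OF this r] obtain \<pi> where \<pi>: "painter_winning V E r (?k - 1) \<pi>" by blast
  obtain a d where f: "force V E r a ?k d []" using builder_wins_imp_force[OF wins r] by blast
  have "is_threshold V E r (\<lambda>n. real n powr (1 - 1 / real ?k))"
    unfolding is_threshold_def
    using \<pi> painter_winning_aas_avoids[OF \<pi> k] force_imp_aas_creates[OF f r k]
    unfolding painter_winning_def by blast
  then show ?thesis using painter_winning_aas_avoids[OF _ k] by blast
qed

end
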